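(* Let $K/\mathbb{Q}$ be a number field, $\mathfrak{p}$ a nonzero prime ideal of $\mathcal{O}_K$, and $T$ a nonempty set of nonzero prime ideals of $\mathcal{O}_K$. Then the arithmetic subderivative $D_{K,T}$ is $\mathfrak{p}$-adically continuous at $x = 0$.
   Context: For a nonzero prime ideal $\mathfrak{q}$ of the ring of integers of a number field lying over the rational prime $q$, $\nu_{\mathfrak{q}}$ denotes the associated discrete valuation normalized to extend $\nu_q$, and for a finite Galois extension $L/\mathbb{Q}$, $g(q,L)$ is the number of prime ideals of $\mathcal{O}_L$ over $q$. For $L/\mathbb{Q}$ finite Galois and a set $T'$ of nonzero prime ideals of $\mathcal{O}_L$, $D_{L,T'}(0)=0$ and $D_{L,T'}(x) := x\sum_{\mathfrak{Q}\in T'} \frac{\nu_{\mathfrak{Q}}(x)}{q\,g(q,L)}$ for $x\ne 0$ ($q$ the prime below $\mathfrak{Q}$). For a number field $K$ and a set $T$ of prime ideals of $\mathcal{O}_K$, choose a finite extension $L/K$ with $L/\mathbb{Q}$ Galois, let $T_{L/K}$ be the prime ideals of $\mathcal{O}_L$ lying over elements of $T$, and define the arithmetic subderivative $D_{K,T}(x) := D_{L,T_{L/K}}(x)$ for $x \in K$ (independent of $L$). The $\mathfrak{p}$-adic topology on $K$ is given by the absolute value $|x|_{\nu_{\mathfrak{p}}} = c^{\nu_{\mathfrak{p}}(x)}$, $0<c<1$ fixed. *)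

theory Defs
  imports "HOL-Algebra.Algebraic_Closure_Type" "HOL-Algebra.Ideal_Product"
begin

text \<open>
  Number fields are realised as subfields of an arbitrary algebraically closed field \<open>'a\<close> of
  characteristic 0.  The ambient field has to contain the Galois extensions \<open>L\<close> of a given number
  field \<open>K\<close>; any field \<open>'k\<close> of characteristic 0 embeds into the instance \<open>'k alg_closure\<close>.
\<close>

definition number_field :: "'a::field_char_0 set \<Rightarrow> bool" where
  "number_field K \<longleftrightarrow> subfield K ring_of_type_algebra \<and>
     ring.finite_dimension ring_of_type_algebra \<rat> K"

text \<open>
  Finite Galois over the rationals = finite, normal and separable: every irreducible rational
  polynomial with a root in \<open>L\<close> is a product of pairwise distinct linear factors over \<open>L\<close>.
\<close>

definition galois_number_field :: "'a::field_char_0 set \<Rightarrow> bool" where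
  "galois_number_field L \<longleftrightarrow> number_field L \<and>
     (\<forall>f :: rat poly. Factorial_Ring.irreducible f \<longrightarrow>
        (\<exists>x\<in>L. poly (map_poly of_rat f) x = 0) \<longrightarrow>
        (\<exists>rs. set rs \<subseteq> L \<and> distinct rs \<and>
           map_poly of_rat f =
             Polynomial.smult (of_rat (Polynomial.lead_coeff f)) (\<Prod>r\<leftarrow>rs. [:- r, 1:])))"

definition int_ring :: "'a::field_char_0 set \<Rightarrow> 'a ring" where
  "int_ring K = ring_of_type_algebra \<lparr> carrier := {x \<in> K. algebraic_int x} \<rparr>"

definition nonzero_primes :: "'a::field_char_0 set \<Rightarrow> 'a set set" where
  "nonzero_primes K = {P. primeideal P (int_ring K) \<and> P \<noteq> {0}}"

definition lies_over_nat :: "'a::field_char_0 set \<Rightarrow> nat \<Rightarrow> bool" where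
  "lies_over_nat P q \<longleftrightarrow> Factorial_Ring.prime q \<and> P \<inter> \<int> = range (\<lambda>k. of_int (int q * k))"

definition prime_below :: "'a::field_char_0 set \<Rightarrow> nat" where
  "prime_below P = (THE q. lies_over_nat P q)"

definition num_primes_over :: "nat \<Rightarrow> 'a::field_char_0 set \<Rightarrow> nat" where
  "num_primes_over q L = card {Q \<in> nonzero_primes L. lies_over_nat Q q}"

definition primes_above :: "'a::field_char_0 set \<Rightarrow> 'a set \<Rightarrow> 'a set set \<Rightarrow> 'a set set" where
  "primes_above L K T = {Q \<in> nonzero_primes L. Q \<inter> carrier (int_ring K) \<in> T}"

text \<open>
  \<open>ord_int K P a\<close> is the exponent of \<open>P\<close> in \<open>(a)\<close> for nonzero integral \<open>a\<close>, \<open>ord_frac\<close> its extension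
  to the nonzero elements of \<open>K\<close> (with value group the integers), and \<open>val\<close> the rescaling which
  extends the \<open>q\<close>-adic valuation of the rationals.  All three are meant for nonzero arguments only;
  the infinite valuation of \<open>0\<close> is accounted for where they are used.
\<close>

definition ord_int :: "'a::field_char_0 set \<Rightarrow> 'a set \<Rightarrow> 'a \<Rightarrow> nat" where
  "ord_int K P a = (GREATEST n. a \<in> P [^]\<^bsub>ideals_set (int_ring K)\<^esub> n)"

definition ord_frac :: "'a::field_char_0 set \<Rightarrow> 'a set \<Rightarrow> 'a \<Rightarrow> int" where
  "ord_frac K P x = (THE k. \<exists>a \<in> carrier (int_ring K) - {0}. \<exists>b \<in> carrier (int_ring K) - {0}.
     x = a / b \<and> k = int (ord_int K P a) - int (ord_int K P b))"

definition val :: "'a::field_char_0 set \<Rightarrow> 'a set \<Rightarrow> 'a \<Rightarrow> rat" where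
  "val K P x = of_int (ord_frac K P x) / of_int (ord_frac K P (of_nat (prime_below P)))"

text \<open>
  The sum over \<open>T\<close> is restricted to its (finite) support, since \<open>T\<close> may be infinite.
\<close>

definition subderiv_galois :: "'a::field_char_0 set \<Rightarrow> 'a set set \<Rightarrow> 'a \<Rightarrow> 'a" where
  "subderiv_galois L T x = (if x = 0 then 0 else
     x * of_rat (\<Sum>Q \<in> {Q \<in> T. val L Q x \<noteq> 0}.
       val L Q x / (of_nat (prime_below Q) * of_nat (num_primes_over (prime_below Q) L))))"

text \<open>
  Finiteness of \<open>L\<close> over \<open>K\<close> is implied by its finiteness over the rationals.
\<close>

definition galois_extension_of :: "'a::field_char_0 set \<Rightarrow> 'a set" where
  "galois_extension_of K = (SOME L. K \<subseteq> L \<and> galois_number_field L)"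

definition arith_subderiv :: "'a::{alg_closed_field, field_char_0} set \<Rightarrow> 'a set set \<Rightarrow> 'a \<Rightarrow> 'a" where
  "arith_subderiv K T x =
     subderiv_galois (galois_extension_of K) (primes_above (galois_extension_of K) K T) x"

definition padic_abs :: "real \<Rightarrow> 'a::field_char_0 set \<Rightarrow> 'a set \<Rightarrow> 'a \<Rightarrow> real" where
  "padic_abs c K P x = (if x = 0 then 0 else c powr real_of_rat (val K P x))"

definition padic_continuous_at ::
  "real \<Rightarrow> 'a::field_char_0 set \<Rightarrow> 'a set \<Rightarrow> ('a \<Rightarrow> 'a) \<Rightarrow> 'a \<Rightarrow> bool" where
  "padic_continuous_at c K P f a \<longleftrightarrow> a \<in> K \<and> f \<in> K \<rightarrow> K \<and>
     (\<forall>\<epsilon>>0. \<exists>\<delta>>0. \<forall>x\<in>K. padic_abs c K P (x - a) < \<delta> \<longrightarrow> padic_abs c K P (f x - f a) < \<epsilon>)"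

end

theory Submission
  imports Defs
begin

text \<open>
  For \<open>x \<noteq> 0\<close> the subderivative is \<open>x\<close> times a rational number \<open>S x\<close>, namely a sum of terms
  \<open>k / (e * q * g)\<close> where \<open>k\<close> is an integer, \<open>q\<close> a rational prime, \<open>e\<close> a ramification index and \<open>g\<close> a
  number of primes of \<open>L\<close> over \<open>q\<close>.  Both \<open>e\<close> and \<open>g\<close> are at most \<open>n = [L : \<rat>]\<close>.  Hence, for \<open>p\<close> the
  rational prime below \<open>\<pp>\<close>, multiplication by the fixed integer \<open>N = p * (n!)\<^sup>2\<close> clears all powers of
  \<open>p\<close> from the denominator of \<open>S x\<close>, so the valuation of \<open>D x\<close> is at least that of \<open>x\<close> minus that of \<open>N\<close>,
  which gives continuity at 0.

  All bounds come from one fact: a strictly descending chain of additive subgroups, the last of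
  which contains the \<open>q\<close>-multiples of elements separating the steps, has length at most the degree
  of the field, because the separating elements are linearly independent modulo \<open>q\<close>.  The same fact
  replaces the Noetherian property in the proof that \<open>\<pp>\<close> has a local uniformizer.
\<close>


section \<open>Subfields and linear dependence over the rationals\<close>

abbreviation R\<^sub>0 :: "'a::field_char_0 ring" where "R\<^sub>0 \<equiv> ring_of_type_algebra"

lemma type_ring_simps [simp]:
  "carrier R\<^sub>0 = UNIV" "x \<otimes>\<^bsub>R\<^sub>0\<^esub> y = x * y" "x \<oplus>\<^bsub>R\<^sub>0\<^esub> y = x + y" "\<zero>\<^bsub>R\<^sub>0\<^esub> = 0" "\<one>\<^bsub>R\<^sub>0\<^esub> = 1"
  by (simp_all add: ring_of_type_algebra_def)

lemma type_ring_field: "field R\<^sub>0"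
  by (rule field_from_type_algebra)

lemma type_ring_a_inv [simp]: "\<ominus>\<^bsub>R\<^sub>0\<^esub> x = - x"
proof -
  interpret field R\<^sub>0 by (rule type_ring_field)
  show ?thesis using sum_zero_eq_neg[of "-x" x] by simp
qed

lemma type_ring_m_inv [simp]: "x \<noteq> 0 \<Longrightarrow> inv\<^bsub>R\<^sub>0\<^esub> x = inverse x"
proof -
  assume "x \<noteq> 0"
  interpret field R\<^sub>0 by (rule type_ring_field)
  show ?thesis using comm_inv_char[of x "inverse x"] \<open>x \<noteq> 0\<close> by simp
qed

lemma type_subfield_iff:
  "subfield K R\<^sub>0 \<longleftrightarrow> 1 \<in> K \<and> (\<forall>x\<in>K. \<forall>y\<in>K. x + y \<in> K \<and> x * y \<in> K) \<and> (\<forall>x\<in>K. - x \<in> K \<and> inverse x \<in> K)"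
  (is "_ \<longleftrightarrow> ?r")
proof
  interpret field R\<^sub>0 by (rule type_ring_field)
  {
    assume K: "subfield K R\<^sub>0"
    note s = subringE[OF subfieldE(1)[OF K]]
    have "inverse x \<in> K" if "x \<in> K" for x
    proof (cases "x = 0")
      case False
      then show ?thesis using subfield_m_inv(1)[OF K, of x] that by simp
    qed (use that in auto)
    then show ?r using s by auto
  }
  assume r: ?r
  show "subfield K R\<^sub>0"
  proof (rule subfieldI')
    show "subring K R\<^sub>0" using r by (intro subringI) auto
    show "\<And>k. k \<in> K - {\<zero>\<^bsub>R\<^sub>0\<^esub>} \<Longrightarrow> inv\<^bsub>R\<^sub>0\<^esub> k \<in> K" using r by auto
  qed
qed

lemma subfieldD:
  assumes "subfield K R\<^sub>0"
  shows subfield_0: "0 \<in> K"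
    and subfield_mult: "\<And>x y. x \<in> K \<Longrightarrow> y \<in> K \<Longrightarrow> x * y \<in> K"
    and subfield_inverse: "\<And>x. x \<in> K \<Longrightarrow> inverse x \<in> K"
    and subfield_divide: "\<And>x y. x \<in> K \<Longrightarrow> y \<in> K \<Longrightarrow> x / y \<in> K"
    and subfield_power: "\<And>x k. x \<in> K \<Longrightarrow> x ^ k \<in> K"
    and subfield_of_int: "\<And>k. of_int k \<in> K"
    and subfield_of_nat: "\<And>k. of_nat k \<in> K"
    and subfield_of_rat: "\<And>k. of_rat k \<in> K"
proof -
  from assms have 1: "1 \<in> K" and a: "\<And>x y. x \<in> K \<Longrightarrow> y \<in> K \<Longrightarrow> x + y \<in> K"
    and m: "\<And>x y. x \<in> K \<Longrightarrow> y \<in> K \<Longrightarrow> x * y \<in> K"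
    and u: "\<And>x. x \<in> K \<Longrightarrow> - x \<in> K" and i: "\<And>x. x \<in> K \<Longrightarrow> inverse x \<in> K"
    by (auto simp: type_subfield_iff)
  show 0: "0 \<in> K" using a[OF 1 u[OF 1]] by simp
  show "x * y \<in> K" if "x \<in> K" "y \<in> K" for x y using that m by auto
  show "inverse x \<in> K" if "x \<in> K" for x using that i by auto
  show d: "x / y \<in> K" if "x \<in> K" "y \<in> K" for x y
    using m[of x "inverse y"] i[of y] that by (simp add: divide_inverse)
  show "x ^ k \<in> K" if "x \<in> K" for x k using 1 m that by (induction k) auto
  show n: "of_nat k \<in> K" for k using 0 1 a by (induction k) auto
  show z: "of_int k \<in> K" for k by (cases k rule: int_cases2) (use n u in auto)
  show "of_rat k \<in> K" for k
    by (cases k) (use z d in \<open>auto simp: of_rat_rat\<close>)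
qed

lemma Rats_subfield: "subfield \<rat> R\<^sub>0"
  unfolding type_subfield_iff by (auto simp: Rats_inverse)

lemma number_field_subfield: "number_field K \<Longrightarrow> subfield K R\<^sub>0"
  by (simp add: number_field_def)

section \<open>Integer linear relations in a number field\<close>

definition nf_degree :: "'a::field_char_0 set \<Rightarrow> nat" where
  "nf_degree K = (SOME n. ring.dimension R\<^sub>0 n \<rat> K)"

lemma combine_eq_sum:
  "length Ks = length Us \<Longrightarrow> ring.combine R\<^sub>0 Ks Us = (\<Sum>i<length Us. Ks ! i * Us ! i)"
proof -
  interpret field R\<^sub>0 by (rule type_ring_field)
  show "length Ks = length Us \<Longrightarrow> combine Ks Us = (\<Sum>i<length Us. Ks ! i * Us ! i)"
    by (induction Ks Us rule: list_induct2) (simp_all add: sum.lessThan_Suc_shift del: sum.lessThan_Suc)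
qed

lemma common_denominator:
  fixes r :: "nat \<Rightarrow> rat"
  obtains D :: int where "D > 0" "\<And>i. i < k \<Longrightarrow> \<exists>z::int. of_int D * r i = of_int z"
proof
  define den where "den i = snd (quotient_of (r i))" for i
  show "(\<Prod>i<k. den i) > 0"
    by (intro prod_pos) (auto simp: den_def quotient_of_denom_pos')
  fix i assume i: "i < k"
  have "(\<Prod>i<k. den i) = den i * (\<Prod>j\<in>{..<k}-{i}. den j)"
    using i by (simp add: prod.remove)
  moreover have "of_int (den i) * r i = of_int (fst (quotient_of (r i)))"
    using quotient_of_div[of "r i" "fst (quotient_of (r i))" "den i"] quotient_of_denom_pos'[of "r i"]
    by (simp add: den_def nonzero_eq_divide_eq mult.commute)
  ultimately have "of_int (\<Prod>i<k. den i) * r i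
      = of_int (fst (quotient_of (r i)) * (\<Prod>j\<in>{..<k}-{i}. den j))"
    by (simp add: mult_ac)
  then show "\<exists>z::int. of_int (\<Prod>i<k. den i) * r i = of_int z" by blast
qed

text \<open>More elements than the degree are linearly dependent over the rationals, and a common
  denominator of the coefficients turns them into integers.\<close>

lemma number_field_int_dependent:
  assumes K: "number_field K" and k: "k > nf_degree K" and a: "\<And>i. i < k \<Longrightarrow> a i \<in> K"
  obtains d :: "nat \<Rightarrow> int" where "\<exists>i<k. d i \<noteq> 0" "(\<Sum>i<k. of_int (d i) * a i) = 0"
proof -
  interpret field R\<^sub>0 by (rule type_ring_field)
  have "\<exists>n. dimension n \<rat> K"
    using K unfolding number_field_def finite_dimension_def by (simp add: over_def)
  then have dim: "dimension (nf_degree K) \<rat> K"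
    unfolding nf_degree_def by (rule someI_ex)
  define Us where "Us = map a [0..<k]"
  have Us: "length Us = k" "\<And>i. i < k \<Longrightarrow> Us ! i = a i" by (auto simp: Us_def)
  have "set Us \<subseteq> K" using a by (auto simp: Us_def)
  then have "dependent \<rat> Us"
    using independent_length_le_dimension[OF Rats_subfield dim, of Us] k Us by linarith
  then obtain Ks where Ks: "length Ks = length Us" "combine Ks Us = 0" "set Ks \<subseteq> \<rat>" "set Ks \<noteq> {0}"
    using dependent_imp_non_trivial_combine[OF Rats_subfield, of Us] by auto
  have "\<forall>i<k. \<exists>r. Ks ! i = of_rat r"
    using Ks Us by (metis Rats_cases nth_mem subsetD)
  then obtain r where r: "\<And>i. i < k \<Longrightarrow> Ks ! i = of_rat (r i)" by metis
  obtain D where D: "D > 0" "\<And>i. i < k \<Longrightarrow> \<exists>z::int. of_int D * r i = of_int z"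
    using common_denominator[of k r] by blast
  then obtain z where z: "\<And>i. i < k \<Longrightarrow> of_int D * r i = of_int (z i)" by metis
  have "set Ks \<noteq> {}" using Ks Us k by auto
  then obtain i where i: "i < k" "Ks ! i \<noteq> 0" using Ks Us by (metis in_set_conv_nth is_singletonI' is_singleton_def singletonD insertI1)
  then have "z i \<noteq> 0" using z[of i] r[of i] D by auto
  have zi: "of_int (z i) = of_int D * Ks ! i" if "i < k" for i
    using arg_cong[OF z[OF that], of "of_rat :: rat \<Rightarrow> 'a"] r[OF that] by (simp add: of_rat_mult)
  have "(\<Sum>i<k. of_int (z i) * a i) = of_int D * (\<Sum>i<k. Ks ! i * Us ! i)"
    by (simp add: zi Us sum_distrib_left mult.assoc)
  also have "\<dots> = 0" using Ks Us combine_eq_sum[of Ks Us] by simp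
  finally show ?thesis using that i \<open>z i \<noteq> 0\<close> by blast
qed

text \<open>Dividing an integer relation by the gcd \<open>G\<close> of its coefficients makes it
  primitive: if \<open>q\<close> divided all the quotients, \<open>G * q\<close> would divide
  \<open>G\<close>.\<close>

lemma number_field_dependent_mod:
  fixes q :: int
  assumes K: "number_field K" and k: "k > nf_degree K" and a: "\<And>i. i < k \<Longrightarrow> a i \<in> K"
    and q: "\<not> is_unit q"
  obtains d :: "nat \<Rightarrow> int" where "\<exists>i<k. \<not> q dvd d i" "(\<Sum>i<k. of_int (d i) * a i) = 0"
proof -
  obtain d where d: "\<exists>i<k. d i \<noteq> 0" "(\<Sum>i<k. of_int (d i) * a i) = 0"
    using number_field_int_dependent[of K k a] K k a by blast
  define G where "G = Gcd (d ` {..<k})"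
  have G0: "G \<noteq> 0" using d by (auto simp: G_def)
  have Gd: "G dvd d i" if "i < k" for i using that by (auto simp: G_def)
  define d' where "d' i = d i div G" for i
  have d': "d i = G * d' i" if "i < k" for i using Gd[OF that] by (simp add: d'_def)
  have "of_int G * (\<Sum>i<k. of_int (d' i) * a i) = (\<Sum>i<k. of_int (d i) * a i)"
    by (simp add: sum_distrib_left d' mult.assoc)
  then have "(\<Sum>i<k. of_int (d' i) * a i) = 0" using d G0 by simp
  moreover have "\<exists>i<k. \<not> q dvd d' i"
  proof (rule ccontr)
    assume "\<not> ?thesis"
    then have "\<And>i. i < k \<Longrightarrow> G * q dvd d i" using d' by auto
    then have "G * q dvd G" unfolding G_def[symmetric] by (subst (2) G_def) (auto intro!: Gcd_greatest)
    then show False using G0 q by auto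
  qed
  ultimately show ?thesis using that by blast
qed

section \<open>Chains of additive subgroups\<close>

lemma bezout_prime_int:
  fixes q c :: int
  assumes "Factorial_Ring.prime q" "\<not> q dvd c"
  obtains u v where "u * c + v * q = 1"
proof -
  have "gcd c q = 1"
    using assms by (metis coprime_iff_gcd_eq_1 gcd.commute prime_imp_coprime)
  then show ?thesis using bezout_int[of c q] that by metis
qed

text \<open>Suppose the \<open>a i\<close> satisfy a relation with coefficients not all divisible by
  \<open>q\<close>, and let \<open>d i\<close> be the first one that is not. The earlier terms lie
  in \<open>I k\<close>, being multiples of some \<open>of_int q * a j\<close>; the later ones lie
  in \<open>I (Suc i)\<close> because the chain descends. So \<open>of_int (d i) * a i\<close> lies
  in \<open>I (Suc i)\<close>, and Bezout for \<open>d i\<close> and \<open>q\<close> puts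
  \<open>a i\<close> itself there, against \<open>aI'\<close>.\<close>

lemma chain_length_le_degree:
  fixes q :: int and I :: "nat \<Rightarrow> 'a::field_char_0 set"
  assumes K: "number_field K" and q: "Factorial_Ring.prime q"
    and I0: "\<And>i. 0 \<in> I i"
    and Iadd: "\<And>i x y. x \<in> I i \<Longrightarrow> y \<in> I i \<Longrightarrow> x + y \<in> I i"
    and Imult: "\<And>i x c. x \<in> I i \<Longrightarrow> of_int c * x \<in> I i"
    and Isub: "\<And>i j. i \<le> j \<Longrightarrow> j \<le> k \<Longrightarrow> I j \<subseteq> I i"
    and aK: "\<And>i. i < k \<Longrightarrow> a i \<in> K"
    and aI: "\<And>i. i < k \<Longrightarrow> a i \<in> I i" and aI': "\<And>i. i < k \<Longrightarrow> a i \<notin> I (Suc i)"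
    and qa: "\<And>i. i < k \<Longrightarrow> of_int q * a i \<in> I k"
  shows "k \<le> nf_degree K"
proof (rule ccontr)
  assume "\<not> ?thesis"
  then have k: "k > nf_degree K" by simp
  have "\<not> is_unit q" using q by auto
  then obtain d where d: "\<exists>i<k. \<not> q dvd d i" "(\<Sum>i<k. of_int (d i) * a i) = 0"
    using number_field_dependent_mod[of K k a q] K k aK by metis
  define i where "i = (LEAST i. i < k \<and> \<not> q dvd d i)"
  have i: "i < k" "\<not> q dvd d i" using LeastI_ex[OF d(1)] by (auto simp: i_def)
  have least: "q dvd d j" if "j < i" for j
    using not_less_Least[of j "\<lambda>i. i < k \<and> \<not> q dvd d i"] that i by (auto simp: i_def)
  have Isum: "finite A \<Longrightarrow> (\<And>j. j \<in> A \<Longrightarrow> f j \<in> I (Suc i)) \<Longrightarrow> sum f A \<in> I (Suc i)" for f and A :: "nat set"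
    by (induction A rule: finite_induct) (auto intro: I0 Iadd)
  have "(\<Sum>j\<in>{..<k}-{i}. of_int (d j) * a j) \<in> I (Suc i)"
  proof (rule Isum)
    fix j assume j: "j \<in> {..<k}-{i}"
    show "of_int (d j) * a j \<in> I (Suc i)"
    proof (cases "j < i")
      case True
      then obtain c where "d j = q * c" using least[OF True] by (elim dvdE)
      then have "of_int (d j) * a j = of_int c * (of_int q * a j)" by simp
      also have "\<dots> \<in> I k" using j by (intro Imult qa) auto
      finally show ?thesis using Isub[of "Suc i" k] i by auto
    next
      case False
      then have "a j \<in> I (Suc i)" using aI[of j] Isub[of "Suc i" j] j by auto
      then show ?thesis by (rule Imult)
    qed
  qed auto
  then have "of_int (-1) * (\<Sum>j\<in>{..<k}-{i}. of_int (d j) * a j) \<in> I (Suc i)" by (rule Imult)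
  moreover have "(\<Sum>i<k. of_int (d i) * a i) = of_int (d i) * a i + (\<Sum>j\<in>{..<k}-{i}. of_int (d j) * a j)"
    using i by (simp add: sum.remove)
  ultimately have di: "of_int (d i) * a i \<in> I (Suc i)"
    using d(2) by (metis eq_neg_iff_add_eq_0 mult_minus1 of_int_1 of_int_minus)
  obtain u v where uv: "u * d i + v * q = 1" using bezout_prime_int[OF q i(2)] .
  have "of_int u * (of_int (d i) * a i) + of_int v * (of_int q * a i) \<in> I (Suc i)"
    using Imult[OF di] Imult[OF qa[OF i(1)]] Isub[of "Suc i" k] i by (intro Iadd) auto
  also have "of_int u * (of_int (d i) * a i) + of_int v * (of_int q * a i) = of_int (u * d i + v * q) * a i"
    by (simp add: algebra_simps)
  finally show False using uv aI'[OF i(1)] by simp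
qed

text \<open>Read backwards, the chain descends and ends in \<open>I 0\<close>. Step \<open>i\<close>
  of the reversed chain is separated by \<open>a (k - Suc i)\<close>.\<close>

lemma ascending_chain_length_le_degree:
  fixes q :: int and I :: "nat \<Rightarrow> 'a::field_char_0 set"
  assumes K: "number_field K" and q: "Factorial_Ring.prime q"
    and I0: "\<And>i. 0 \<in> I i"
    and Iadd: "\<And>i x y. x \<in> I i \<Longrightarrow> y \<in> I i \<Longrightarrow> x + y \<in> I i"
    and Imult: "\<And>i x c. x \<in> I i \<Longrightarrow> of_int c * x \<in> I i"
    and Isub: "\<And>i. I i \<subseteq> I (Suc i)"
    and aK: "\<And>i. i < k \<Longrightarrow> a i \<in> K"
    and aI: "\<And>i. i < k \<Longrightarrow> a i \<in> I (Suc i)" and aI': "\<And>i. i < k \<Longrightarrow> a i \<notin> I i"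
    and qa: "\<And>i. i < k \<Longrightarrow> of_int q * a i \<in> I 0"
  shows "k \<le> nf_degree K"
proof (rule chain_length_le_degree[OF K q, of "\<lambda>i. I (k - i)" k "\<lambda>i. a (k - Suc i)"])
  have mono: "i \<le> j \<Longrightarrow> I i \<subseteq> I j" for i j
    by (rule lift_Suc_mono_le[of I]) (use Isub in auto)
  show "I (k - j) \<subseteq> I (k - i)" if "i \<le> j" "j \<le> k" for i j using that by (intro mono) auto
  show "a (k - Suc i) \<in> I (k - i)" if "i < k" for i
    using aI[of "k - Suc i"] that by (simp add: Suc_diff_Suc)
qed (use assms in auto)

text \<open>The powers of \<open>x\<close> up to the degree are dependent. With \<open>D\<close> the
  leading coefficient of the relation and \<open>k\<close> its degree, multiplication by
  \<open>D ^ (k - 1)\<close> turns it into a monic integer equation for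
  \<open>D * x\<close>.\<close>

lemma number_field_integral_multiple:
  assumes K: "number_field K" and x: "x \<in> K"
  obtains m :: int where "m \<noteq> 0" "algebraic_int (of_int m * x)"
proof -
  obtain d where d: "\<exists>i<Suc (nf_degree K). d i \<noteq> 0" "(\<Sum>i<Suc (nf_degree K). of_int (d i) * x ^ i) = 0"
    using number_field_int_dependent[OF K, of "Suc (nf_degree K)" "\<lambda>i. x ^ i"]
      subfield_power[OF number_field_subfield[OF K] x] by blast
  \<comment> \<open>The relation may have zero coefficients at the top, so its true degree is the
    largest index in \<open>S\<close>.\<close>
  define S where "S = {i. i < Suc (nf_degree K) \<and> d i \<noteq> 0}"
  have S: "finite S" "S \<noteq> {}" using d by (auto simp: S_def)
  define k where "k = Max S"
  have kS: "k \<in> S" using Max_in[OF S] by (simp add: k_def)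
  define D where "D = d k"
  have D: "D \<noteq> 0" using kS by (auto simp: S_def D_def)
  have z: "d i = 0" if "i > k" "i < Suc (nf_degree K)" for i
  proof (rule ccontr)
    assume "d i \<noteq> 0"
    then have "i \<in> S" using that by (simp add: S_def)
    then show False using Max_ge[OF S(1), of i] that by (simp add: k_def)
  qed
  have "(\<Sum>i\<le>k. of_int (d i) * x ^ i) = (\<Sum>i<Suc (nf_degree K). of_int (d i) * x ^ i)"
    using kS z by (intro sum.mono_neutral_left) (auto simp: S_def)
  then have sum0: "of_int D * x ^ k + (\<Sum>i<k. of_int (d i) * x ^ i) = 0"
    using d(2) by (simp add: lessThan_Suc_atMost[symmetric] D_def add.commute del: sum.lessThan_Suc)
        (simp add: add.commute)
  show ?thesis
  proof (cases "k = 0")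
    case True
    then have False using sum0 D by simp
    then show ?thesis ..
  next
    case False
    define p :: "'a poly" where
      "p = Polynomial.monom 1 k + (\<Sum>i<k. Polynomial.monom (of_int (d i * D ^ (k - 1 - i))) i)"
    have cp: "Polynomial.coeff p i = (if i = k then 1 else if i < k then of_int (d i * D ^ (k - 1 - i)) else 0)" for i
      by (auto simp: p_def coeff_sum coeff_monom)
    have deg: "Polynomial.degree p = k"
      by (intro antisym degree_le le_degree) (auto simp: cp)
    have "poly p (of_int D * x) = of_int D ^ k * x ^ k + (\<Sum>i<k. of_int D ^ (k - 1) * (of_int (d i) * x ^ i))"
    proof -
      have "(of_int D ^ (k - 1) :: 'a) = of_int D ^ (k - 1 - i) * of_int D ^ i" if "i < k" for i
        using that by (simp flip: power_add)
      then show ?thesis unfolding p_def poly_add poly_sum poly_monom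
        by (intro arg_cong2[where f = "(+)"] sum.cong) (simp_all add: power_mult_distrib mult_ac)
    qed
    also have "\<dots> = of_int D ^ (k - 1) * (of_int D * x ^ k + (\<Sum>i<k. of_int (d i) * x ^ i))"
      using False by (simp add: sum_distrib_left distrib_left power_eq_if mult_ac)
    also have "\<dots> = 0" by (simp add: sum0)
    finally have "algebraic_int (of_int D * x)"
      by (intro algebraic_int.intros[of p]) (auto simp: cp deg)
    then show ?thesis using that D by blast
  qed
qed

section \<open>Prime ideals of rings of integers\<close>

locale nf_prime =
  fixes K :: "'a::field_char_0 set" and P :: "'a set"
  assumes K: "number_field K" and P: "P \<in> nonzero_primes K"
begin

abbreviation \<O> where "\<O> \<equiv> {x \<in> K. algebraic_int x}"

lemma int_ring_simps [simp]:
  "carrier (int_ring K) = \<O>" "x \<otimes>\<^bsub>int_ring K\<^esub> y = x * y" "x \<oplus>\<^bsub>int_ring K\<^esub> y = x + y"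
  "\<zero>\<^bsub>int_ring K\<^esub> = 0" "\<one>\<^bsub>int_ring K\<^esub> = 1"
  by (simp_all add: int_ring_def ring_of_type_algebra_def)

lemma primeideal_P: "primeideal P (int_ring K)"
  using P by (simp add: nonzero_primes_def)

sublocale OK: cring "int_ring K"
  using primeideal_P by (rule primeideal.axioms(2))

lemma ideal_P: "ideal P (int_ring K)"
  using primeideal_P by (rule primeideal.axioms(1))

lemmas K_sub = number_field_subfield[OF K]

section \<open>Closure properties of the ring of integers and of its ideals\<close>

lemma O_add: "x \<in> \<O> \<Longrightarrow> y \<in> \<O> \<Longrightarrow> x + y \<in> \<O>"
  using OK.a_closed[of x y] by simp

lemma O_mult: "x \<in> \<O> \<Longrightarrow> y \<in> \<O> \<Longrightarrow> x * y \<in> \<O>"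
  using OK.m_closed[of x y] by simp

lemma O_of_int: "of_int c \<in> \<O>"
  using subfield_of_int[OF K_sub] by auto

lemma O_of_nat: "of_nat c \<in> \<O>"
  using subfield_of_nat[OF K_sub] by auto

lemma O_0: "0 \<in> \<O>" and O_1: "1 \<in> \<O>"
  using O_of_int[of 0] O_of_int[of 1] by auto

lemma O_uminus: "x \<in> \<O> \<Longrightarrow> - x \<in> \<O>"
  using O_mult[OF O_of_int[of "-1"], of x] by simp

lemma O_power: "x \<in> \<O> \<Longrightarrow> x ^ k \<in> \<O>"
  by (induction k) (use O_1 O_mult in auto)

lemma ideal_0: "ideal I (int_ring K) \<Longrightarrow> 0 \<in> I"
  using additive_subgroup.zero_closed[OF ideal.axioms(1)] by fastforce

lemma ideal_add: "ideal I (int_ring K) \<Longrightarrow> x \<in> I \<Longrightarrow> y \<in> I \<Longrightarrow> x + y \<in> I"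
  using additive_subgroup.a_closed[OF ideal.axioms(1)] by fastforce

lemma ideal_mult: "ideal I (int_ring K) \<Longrightarrow> x \<in> I \<Longrightarrow> y \<in> \<O> \<Longrightarrow> y * x \<in> I"
  using ideal.I_l_closed[of I "int_ring K" x y] by simp

lemma ideal_O: "ideal I (int_ring K) \<Longrightarrow> x \<in> I \<Longrightarrow> x \<in> \<O>"
  using ideal.Icarr by fastforce

lemmas P_0 = ideal_0[OF ideal_P] and P_add = ideal_add[OF ideal_P]
  and P_mult = ideal_mult[OF ideal_P] and P_O = ideal_O[OF ideal_P]

lemma P_uminus: "x \<in> P \<Longrightarrow> - x \<in> P"
  using P_mult[OF _ O_of_int[of "-1"], of x] by simp

lemma P_diff: "x \<in> P \<Longrightarrow> y \<in> P \<Longrightarrow> x - y \<in> P"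
  using P_add[OF _ P_uminus, of x y] by simp

lemma P_prime: "x \<in> \<O> \<Longrightarrow> y \<in> \<O> \<Longrightarrow> x * y \<in> P \<Longrightarrow> x \<in> P \<or> y \<in> P"
  using primeideal.I_prime[OF primeideal_P, of x y] by simp

lemma P_1: "1 \<notin> P"
proof
  assume "1 \<in> P"
  then have "x \<in> P" if "x \<in> \<O>" for x using P_mult[of 1 x] that by simp
  then have "P = \<O>" using P_O by blast
  then show False using primeideal.I_notcarr[OF primeideal_P] by simp
qed

lemma P_power: "x \<in> \<O> \<Longrightarrow> x ^ k \<in> P \<Longrightarrow> x \<in> P"
  by (induction k) (use P_1 P_prime O_power in auto)

section \<open>The rational prime below \<open>P\<close>\<close>

lemma ipoly_O: "x \<in> \<O> \<Longrightarrow> poly (map_poly of_int f) x \<in> \<O>"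
  by (induction f) (use O_0 O_add O_mult O_of_int in \<open>auto simp: map_poly_pCons\<close>)

text \<open>A nonzero constant term of an integral equation of \<open>x\<close> is a multiple of
  \<open>x\<close>. A zero constant term allows cancelling one factor \<open>x\<close> from the
  equation, hence the induction on \<open>f\<close>.\<close>

lemma divides_int:
  assumes x: "x \<in> \<O>" "x \<noteq> 0"
  obtains m :: int and y where "m \<noteq> 0" "y \<in> \<O>" "x * y = of_int m"
proof -
  obtain f where f: "poly (map_poly of_int f) x = 0" "Polynomial.lead_coeff f = 1"
    using x by (auto simp: algebraic_int_altdef_ipoly)
  then have "f \<noteq> 0" by auto
  then have "\<exists>m::int. \<exists>y\<in>\<O>. m \<noteq> 0 \<and> x * y = of_int m" using f(1)
  proof (induction f)
    case (pCons c h)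
    show ?case
    proof (cases "c = 0")
      case True
      then show ?thesis using pCons x by (auto simp: map_poly_pCons)
    next
      case False
      have "x * (- poly (map_poly of_int h) x) = of_int c"
        using pCons.prems by (simp add: map_poly_pCons eq_neg_iff_add_eq_0 minus_equation_iff add.commute)
          (simp add: add_eq_0_iff)
      then show ?thesis using False O_uminus[OF ipoly_O[OF x(1), of h]] by blast
    qed
  qed simp
  then show ?thesis using that by blast
qed

text \<open>A nonzero element of \<open>P\<close> divides a nonzero integer, so \<open>P\<close>
  contains a positive integer. As \<open>P\<close> is prime, it contains one of the prime
  factors.\<close>

lemma ex_prime_in_P: "\<exists>q::nat. Factorial_Ring.prime q \<and> of_nat q \<in> P"
proof -
  obtain x where x: "x \<in> P" "x \<noteq> 0"
    using P P_0 by (auto simp: nonzero_primes_def)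
  obtain m y where m: "m \<noteq> 0" "y \<in> \<O>" "x * y = of_int m"
    using divides_int[OF P_O[OF x(1)] x(2)] by blast
  then have "of_int m \<in> P" using P_mult[OF x(1) m(2)] by (simp add: mult.commute)
  then have "of_nat (nat \<bar>m\<bar>) \<in> P" using P_uminus[of "of_int m"] by (cases "m \<ge> 0") auto
  moreover have "nat \<bar>m\<bar> > 0" using m by simp
  moreover have "of_nat k \<in> P \<Longrightarrow> k > 0 \<Longrightarrow> ?thesis" for k :: nat
  proof (induction k rule: less_induct)
    case (less k)
    have "k \<noteq> 1" using less P_1 by auto
    then obtain q where q: "Factorial_Ring.prime q" "q dvd k" using prime_factor_nat by blast
    then obtain l where l: "k = q * l" by (elim dvdE)
    then have "(of_nat q :: 'a) * of_nat l \<in> P" using less by simp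
    then consider "(of_nat q :: 'a) \<in> P" | "(of_nat l :: 'a) \<in> P" using P_prime O_of_nat by blast
    then show ?case
    proof cases
      case 2
      have "l < k" "l > 0" using l less.prems prime_gt_1_nat[OF q(1)] by auto
      then show ?thesis using less.IH 2 by blast
    qed (use q in auto)
  qed
  ultimately show ?thesis by blast
qed

definition p :: nat where "p = prime_below P"

text \<open>An integer of \<open>P\<close> outside the multiples of \<open>q\<close> would by Bezout
  give \<open>1 \<in> P\<close>.\<close>

lemma lies_over_natI:
  assumes q: "Factorial_Ring.prime q" "of_nat q \<in> P"
  shows "lies_over_nat P q"
proof -
  have "int q dvd c" if c: "of_int c \<in> P" for c
  proof (rule ccontr)
    assume "\<not> int q dvd c"
    then obtain u v where uv: "u * c + v * int q = 1" using bezout_prime_int[of "int q" c] q by auto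
    have "of_int u * of_int c + of_int v * of_nat q \<in> P"
      using c q by (intro P_add P_mult O_of_int) auto
    also have "(of_int u * of_int c + of_int v * of_nat q :: 'a) = of_int (u * c + v * int q)" by simp
    finally show False using uv P_1 by simp
  qed
  then have "of_int c \<in> range (\<lambda>k. of_int (int q * k) :: 'a)" if "of_int c \<in> P" for c
    using that by (metis dvdE rangeI)
  moreover have "of_int (int q * k) \<in> P" for k
    using P_mult[OF q(2) O_of_int[of k]] by (simp add: mult.commute)
  ultimately have "P \<inter> \<int> = range (\<lambda>k. of_int (int q * k))"
    by (intro equalityI subsetI) (auto simp del: of_int_mult elim!: Ints_cases)
  then show ?thesis using q(1) unfolding lies_over_nat_def by blast
qed

lemma lies_over_natD:
  assumes "lies_over_nat P q"
  shows "Factorial_Ring.prime q" "of_int c \<in> P \<longleftrightarrow> int q dvd c"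
proof -
  show "Factorial_Ring.prime q" using assms by (simp add: lies_over_nat_def)
  have "of_int c \<in> P \<longleftrightarrow> of_int c \<in> P \<inter> \<int>" by simp
  also have "\<dots> \<longleftrightarrow> (of_int c :: 'a) \<in> range (\<lambda>k. of_int (int q * k))"
    using assms by (simp only: lies_over_nat_def)
  also have "\<dots> \<longleftrightarrow> (\<exists>k. c = int q * k)"
    by (simp only: image_iff of_int_eq_iff) simp
  finally show "of_int c \<in> P \<longleftrightarrow> int q dvd c" by (auto simp: dvd_def)
qed

lemma lies_over_nat_unique:
  assumes "lies_over_nat P q" "lies_over_nat P r" shows "q = r"
proof -
  have "int q dvd c \<longleftrightarrow> int r dvd c" for c
    using lies_over_natD(2)[OF assms(1), of c] lies_over_natD(2)[OF assms(2), of c] by argo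
  from this[of "int q"] this[of "int r"] show ?thesis by (simp add: dvd_antisym)
qed

text \<open>Existence and uniqueness together ensure that the \<open>THE\<close> in
  \<open>prime_below\<close> denotes.\<close>

lemma lies_over_p: "lies_over_nat P p"
proof -
  have "\<exists>!q. lies_over_nat P q"
    using ex_prime_in_P lies_over_natI lies_over_nat_unique by blast
  then show ?thesis unfolding p_def prime_below_def by (rule theI')
qed

lemmas prime_p = lies_over_natD(1)[OF lies_over_p] and of_int_in_P = lies_over_natD(2)[OF lies_over_p]

section \<open>Reduction of integral equations modulo \<open>p\<close>\<close>

lemma prime_int_p: "Factorial_Ring.prime (int p)" using prime_p by simp

lemma p_in_P: "of_nat p \<in> P" using of_int_in_P[of "int p"] by simp

lemma p_nonzero: "of_nat p \<noteq> (0::'a)" using prime_p by auto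

text \<open>Here \<open>k\<close> is the index of the first coefficient of \<open>f\<close> prime to
  \<open>p\<close>, and \<open>c\<close> is that coefficient. All lower terms are collected in the
  multiple of \<open>p\<close>.\<close>

lemma ipoly_mod_p:
  assumes x: "x \<in> \<O>" and f: "\<exists>i. \<not> int p dvd Polynomial.coeff f i"
  shows "\<exists>k c. \<exists>b\<in>\<O>. \<exists>y\<in>\<O>. \<not> int p dvd c \<and>
    poly (map_poly of_int f) x = x ^ k * (of_int c + x * b) + of_nat p * y"
  using f
proof (induction f)
  case (pCons c h)
  show ?case
  proof (cases "int p dvd c")
    case False
    then show ?thesis
      by (intro exI[of _ 0] exI[of _ c] bexI[OF _ ipoly_O[OF x, of h]] bexI[OF _ O_0])
        (simp add: map_poly_pCons)
  next
    case True
    then have "\<exists>i. \<not> int p dvd Polynomial.coeff h i"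
      using pCons.prems by (metis coeff_pCons_0 coeff_pCons_Suc not0_implies_Suc)
    then obtain k c' b y where h: "b \<in> \<O>" "y \<in> \<O>" "\<not> int p dvd c'"
      "poly (map_poly of_int h) x = x ^ k * (of_int c' + x * b) + of_nat p * y"
      using pCons.IH by blast
    obtain e where e: "c = int p * e" using True by (elim dvdE)
    have "poly (map_poly of_int (pCons c h)) x
        = x ^ Suc k * (of_int c' + x * b) + of_nat p * (of_int e + x * y)"
      by (simp add: map_poly_pCons h e algebra_simps)
    moreover have "of_int e + x * y \<in> \<O>" using O_add O_mult O_of_int x h by blast
    ultimately show ?thesis using h(1,3)
      by (intro exI[of _ "Suc k"] exI[of _ c'] bexI[of _ b] bexI[of _ "of_int e + x * y"]) auto
  qed
qed simp

text \<open>The reduction applies to a monic equation of \<open>x\<close>, as its leading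
  coefficient 1 is prime to \<open>p\<close>. The result serves twice: for the maximality of
  \<open>P\<close> and for the nilpotence argument behind the uniformizer.\<close>

lemma integral_mod_p:
  assumes x: "x \<in> \<O>"
  obtains k c b y where "b \<in> \<O>" "y \<in> \<O>" "\<not> int p dvd c"
    "x ^ k * (of_int c + x * b) = of_nat p * y"
proof -
  obtain f where f: "poly (map_poly of_int f) x = 0" "Polynomial.lead_coeff f = 1"
    using x by (auto simp: algebraic_int_altdef_ipoly)
  have "\<not> int p dvd Polynomial.coeff f (Polynomial.degree f)"
    using f(2) prime_int_p by (auto simp: not_prime_unit)
  then have "\<exists>i. \<not> int p dvd Polynomial.coeff f i" by blast
  from ipoly_mod_p[OF x this] obtain k c b y where h: "b \<in> \<O>" "y \<in> \<O>" "\<not> int p dvd c"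
      "0 = x ^ k * (of_int c + x * b) + of_nat p * y"
    unfolding f(1) by (elim exE bexE conjE) (rule that)
  then have "x ^ k * (of_int c + x * b) = of_nat p * (- y)" by (simp add: eq_neg_iff_add_eq_0)
  then show ?thesis using h(1) O_uminus[OF h(2)] h(3) by (intro that)
qed

text \<open>The reduced equation of \<open>a\<close> gives \<open>c + a * b \<in> P\<close>, because
  \<open>a\<close> is not in \<open>P\<close>. Since \<open>c\<close> is invertible modulo
  \<open>p\<close>, say by \<open>u\<close>, the inverse of \<open>a\<close> modulo \<open>P\<close>
  is \<open>- u * b\<close>.\<close>

lemma P_maximal:
  assumes a: "a \<in> \<O>" "a \<notin> P"
  obtains b where "b \<in> \<O>" "1 - a * b \<in> P"
proof -
  obtain k c b y where h: "b \<in> \<O>" "y \<in> \<O>" "\<not> int p dvd c" "a ^ k * (of_int c + a * b) = of_nat p * y"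
    using integral_mod_p[OF a(1)] .
  have "a ^ k * (of_int c + a * b) \<in> P" using h P_mult[OF p_in_P h(2)] by (simp add: mult.commute)
  then have cb: "of_int c + a * b \<in> P"
    using P_prime[OF O_power[OF a(1)] O_add[OF O_of_int O_mult[OF a(1) h(1)]]] P_power[OF a(1)] a(2)
    by metis
  obtain u v where uv: "u * c + v * int p = 1" using bezout_prime_int[OF prime_int_p h(3)] .
  have "of_int u * (of_int c + a * b) + of_int v * of_nat p \<in> P"
    using P_add[OF P_mult[OF cb O_of_int] P_mult[OF p_in_P O_of_int]] .
  also have "of_int u * (of_int c + a * b) + of_int v * of_nat p = of_int (u * c + v * int p) - a * (- (of_int u * b))"
    by (simp add: algebra_simps)
  finally show ?thesis using uv that[of "- (of_int u * b)"] h O_uminus O_mult O_of_int by simp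
qed

section \<open>Local uniformizers\<close>

text \<open>This is the ideal quotient \<open>(p) : (a)\<close>.\<close>

definition colon :: "'a \<Rightarrow> 'a set" where
  "colon a = {x \<in> \<O>. \<exists>y\<in>\<O>. x * a = of_nat p * y}"

lemma colon_0: "0 \<in> colon a"
  using O_0 by (auto simp: colon_def)

lemma colon_add:
  assumes "x \<in> colon a" "y \<in> colon a" shows "x + y \<in> colon a"
proof -
  from assms obtain t u where xy: "x \<in> \<O>" "y \<in> \<O>"
    and tu: "t \<in> \<O>" "x * a = of_nat p * t" "u \<in> \<O>" "y * a = of_nat p * u"
    by (auto simp: colon_def)
  have "(x + y) * a = of_nat p * (t + u)" by (simp add: distrib_left distrib_right tu)
  then show ?thesis using O_add[OF xy] O_add[OF tu(1,3)] unfolding colon_def by blast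
qed

lemma colon_mult:
  assumes "x \<in> colon a" and y: "y \<in> \<O>" shows "y * x \<in> colon a"
proof -
  from assms(1) obtain t where x: "x \<in> \<O>" and t: "t \<in> \<O>" "x * a = of_nat p * t"
    by (auto simp: colon_def)
  have "(y * x) * a = of_nat p * (y * t)" by (simp add: t mult.assoc mult.left_commute)
  then show ?thesis using O_mult[OF y x] O_mult[OF y t(1)] unfolding colon_def by blast
qed

lemma colon_mono: "y \<in> \<O> \<Longrightarrow> colon a \<subseteq> colon (y * a)"
proof
  fix x assume y: "y \<in> \<O>" and "x \<in> colon a"
  then obtain u where u: "x \<in> \<O>" "u \<in> \<O>" "x * a = of_nat p * u" by (auto simp: colon_def)
  have "x * (y * a) = of_nat p * (y * u)" using u(3) by (simp add: mult.left_commute)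
  then show "x \<in> colon (y * a)" using u(1) O_mult[OF y u(2)] unfolding colon_def by blast
qed

lemma in_colon_mult: "x \<in> \<O> \<Longrightarrow> y \<in> \<O> \<Longrightarrow> x \<in> colon (y * a) \<longleftrightarrow> x * y \<in> colon a"
  using O_mult[of x y] by (auto simp: colon_def mult_ac)

lemma p_in_colon: "a \<in> \<O> \<Longrightarrow> x \<in> \<O> \<Longrightarrow> of_nat p * x \<in> colon a"
  using O_mult[OF O_of_nat[of p], of x] O_mult[of x a] mult.assoc[of _ x a] unfolding colon_def by blast

text \<open>All these ideals contain the multiples of \<open>p\<close>, so the degree bounds the
  length of ascending chains and strict inclusion is well-founded.\<close>

lemma ex_maximal_colon:
  "\<exists>a\<in>\<O>. colon a \<subseteq> P \<and> (\<forall>b\<in>\<O>. colon b \<subseteq> P \<longrightarrow> colon a \<subseteq> colon b \<longrightarrow> colon b = colon a)"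
proof -
  define F where "F = {a \<in> \<O>. colon a \<subseteq> P}"
  define r where "r = {(b, a). a \<in> F \<and> b \<in> F \<and> colon a \<subset> colon b}"
  have "wf r"
    unfolding wf_iff_no_infinite_down_chain
  proof
    assume "\<exists>f. \<forall>i. (f (Suc i), f i) \<in> r"
    then obtain f where f: "\<And>i. (f (Suc i), f i) \<in> r" by blast
    then have fF: "f i \<in> \<O>" and fs: "colon (f i) \<subset> colon (f (Suc i))" for i
      by (auto simp: r_def F_def)
    from fs have "\<forall>i. \<exists>c. c \<in> colon (f (Suc i)) \<and> c \<notin> colon (f i)" by blast
    then obtain c where c: "\<And>i. c i \<in> colon (f (Suc i))" "\<And>i. c i \<notin> colon (f i)" by metis
    have cO: "c i \<in> \<O>" for i using c(1)[of i] by (auto simp: colon_def)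
    have "Suc (nf_degree K) \<le> nf_degree K"
    proof (rule ascending_chain_length_le_degree[OF K prime_int_p, of "\<lambda>i. colon (f i)" _ c])
      show "of_int (int p) * c i \<in> colon (f 0)" for i
        using p_in_colon[OF fF cO] by simp
      show "colon (f i) \<subseteq> colon (f (Suc i))" for i using fs by blast
    qed (use c cO colon_0 colon_add colon_mult[OF _ O_of_int] in auto)
    then show False by simp
  qed
  \<comment> \<open>The family is nonempty: \<open>colon 1\<close> consists of the multiples of
    \<open>p\<close>, which lie in \<open>P\<close>.\<close>
  moreover have "1 \<in> F"
    using O_1 P_mult[OF p_in_P] by (auto simp: F_def colon_def mult.commute)
  ultimately obtain a where a: "a \<in> F" "\<And>b. (b, a) \<in> r \<Longrightarrow> b \<notin> F"
    using wfE_min[of r 1 F] by metis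
  show ?thesis
  proof (intro bexI[of _ a] conjI ballI impI)
    show "colon b = colon a" if "b \<in> \<O>" "colon b \<subseteq> P" "colon a \<subseteq> colon b" for b
      using a(2)[of b] that a(1) by (auto simp: r_def F_def)
  qed (use a in \<open>auto simp: F_def\<close>)
qed

text \<open>
  Modulo \<open>p\<close> every element of \<open>P\<close> becomes nilpotent after multiplication with an element outside
  \<open>P\<close> (reduce an integral equation), so a maximal colon ideal inside \<open>P\<close> is \<open>P\<close> itself.
\<close>

lemma ex_colon_eq_P:
  obtains a where "a \<in> \<O>" "colon a = P"
proof -
  obtain a where a: "a \<in> \<O>" "colon a \<subseteq> P"
    and "\<forall>b\<in>\<O>. colon b \<subseteq> P \<longrightarrow> colon a \<subseteq> colon b \<longrightarrow> colon b = colon a"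
    using ex_maximal_colon by (elim bexE conjE)
  then have amax: "colon b = colon a" if "b \<in> \<O>" "colon b \<subseteq> P" "colon a \<subseteq> colon b" for b
    using that by blast
  \<comment> \<open>Multiplying \<open>a\<close> by an element outside \<open>P\<close> can only
    enlarge the quotient and, \<open>P\<close> being prime, keeps it inside \<open>P\<close>;
    maximality then forces equality.\<close>
  have unit: "colon (s * a) = colon a" if s: "s \<in> \<O>" "s \<notin> P" for s
  proof (rule amax)
    show "s * a \<in> \<O>" using O_mult s a by blast
    show "colon (s * a) \<subseteq> P"
    proof
      fix y assume y: "y \<in> colon (s * a)"
      then have yO: "y \<in> \<O>" by (auto simp: colon_def)
      then have "y * s \<in> P" using in_colon_mult[OF yO s(1)] y a(2) by blast
      then show "y \<in> P" using P_prime[OF yO s(1)] s(2) by blast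
    qed
  qed (use colon_mono s in blast)
  have "x \<in> colon a" if x: "x \<in> P" for x
  proof (rule ccontr)
    assume xa: "x \<notin> colon a"
    have xO: "x \<in> \<O>" using P_O x by blast
    obtain k c b y where h: "b \<in> \<O>" "y \<in> \<O>" "\<not> int p dvd c" "x ^ k * (of_int c + x * b) = of_nat p * y"
      using integral_mod_p[OF xO] .
    define s where "s = of_int c + x * b"
    have sO: "s \<in> \<O>" unfolding s_def using O_add[OF O_of_int O_mult[OF xO h(1)]] .
    have "s \<notin> P"
    proof
      assume "s \<in> P"
      then have "s - b * x \<in> P" using P_diff P_mult[OF x h(1)] by blast
      then show False using h(3) of_int_in_P by (simp add: s_def mult.commute)
    qed
    then have cs: "colon (s * a) = colon a" using unit sO by blast
    have "x ^ k * s \<in> colon a" using p_in_colon[OF a(1) h(2)] h(4) by (simp add: s_def)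
    then have xk: "x ^ k \<in> colon a" using in_colon_mult[OF O_power[OF xO] sO] cs by blast
    \<comment> \<open>With \<open>j\<close> least and \<open>i = j - 1\<close>, the power
      \<open>x ^ i\<close> is the last one outside the quotient, so \<open>x\<close> itself maps it
      into the quotient.\<close>
    define j where "j = (LEAST j. x ^ j \<in> colon a)"
    have j: "x ^ j \<in> colon a" unfolding j_def by (rule LeastI[of _ k]) (rule xk)
    have "x ^ 0 \<notin> colon a" using P_1 a(2) by auto
    then have "j \<noteq> 0" using j by metis
    then obtain i where i: "j = Suc i" using not0_implies_Suc by blast
    have xi: "x ^ i \<notin> colon a" using not_less_Least[of i "\<lambda>j. x ^ j \<in> colon a"] i by (simp add: j_def)
    have xiO: "x ^ i \<in> \<O>" using O_power xO by blast
    \<comment> \<open>A \<open>y\<close> outside \<open>P\<close> in the left-hand ideal would put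
      \<open>x ^ i\<close> into \<open>colon (y * a)\<close>, which equals \<open>colon a\<close> by
      \<open>unit\<close>. So the ideal stays inside \<open>P\<close> and maximality applies. But it
      contains \<open>x\<close>, which gives the contradiction.\<close>
    have "colon (x ^ i * a) = colon a"
    proof (rule amax)
      show "x ^ i * a \<in> \<O>" using O_mult xiO a by blast
      show "colon (x ^ i * a) \<subseteq> P"
      proof (rule subsetI, rule ccontr)
        fix y assume y: "y \<in> colon (x ^ i * a)" "y \<notin> P"
        then have yO: "y \<in> \<O>" by (auto simp: colon_def)
        have "x ^ i * y \<in> colon a" using y in_colon_mult[OF yO xiO] by (simp add: mult.commute)
        then have "x ^ i \<in> colon (y * a)" using in_colon_mult[OF xiO yO] by blast
        then show False using unit[OF yO y(2)] xi by blast
      qed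
    qed (use colon_mono xiO in blast)
    moreover have "x \<in> colon (x ^ i * a)" using in_colon_mult[OF xO xiO] j i by simp
    ultimately show False using xa by blast
  qed
  then show ?thesis using that[of a] a by blast
qed

text \<open>The fraction \<open>g = a / p\<close> is not integral but multiplies \<open>P\<close>
  into the ring of integers. If it mapped \<open>P\<close> into itself, it would be integral; hence
  \<open>g * x\<close> lies outside \<open>P\<close> for some \<open>x \<in> P\<close>. Then
  \<open>w = g * x\<close> and \<open>v = x\<close> work, because
  \<open>w * y = v * (g * y)\<close>.\<close>

lemma ex_uniformizer:
  obtains w v where "w \<in> \<O>" "w \<notin> P" "v \<in> P" "\<And>x. x \<in> P \<Longrightarrow> \<exists>y\<in>\<O>. w * x = v * y"
proof -
  obtain a where a: "a \<in> \<O>" "colon a = P" using ex_colon_eq_P .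
  define g where "g = a / of_nat p"
  have pg: "of_nat p * g = a" using p_nonzero by (simp add: g_def)
  have gK: "g \<in> K" unfolding g_def using subfield_divide[OF K_sub] a subfield_of_nat[OF K_sub] by blast
  have gP: "g * x \<in> \<O>" if "x \<in> P" for x
  proof -
    have "x \<in> colon a" using that a by simp
    then obtain y where "y \<in> \<O>" "x * a = of_nat p * y" by (auto simp: colon_def)
    then show ?thesis using p_nonzero by (simp add: g_def field_simps)
  qed
  have gO: "g \<notin> \<O>"
  proof
    assume "g \<in> \<O>"
    then have "1 \<in> colon a" using O_1 pg by (auto simp: colon_def)
    then show False using a P_1 by simp
  qed
  have "\<exists>x\<in>P. g * x \<notin> P"
  proof (rule ccontr)
    assume "\<not> ?thesis"
    then have gPP: "g * x \<in> P" if "x \<in> P" for x using that by blast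
    \<comment> \<open>All powers of \<open>g\<close> thus share the denominator \<open>p\<close>,
      which keeps the groups \<open>I i\<close> below inside the ring of integers.\<close>
    have gpow: "of_nat p * g ^ i \<in> P" for i
    proof (induction i)
      case (Suc i)
      then show ?case using gPP[OF Suc] by (simp add: mult_ac)
    qed (use p_in_P in simp)
    \<comment> \<open>The groups \<open>\<O> + \<int> + \<int> g + \<dots> + \<int> g ^ i\<close>, scaled into \<open>\<O>\<close>, become stationary, which makes \<open>g\<close> integral.\<close>
    define I where "I i = {of_nat p * (y + poly f g) | y f. y \<in> \<O> \<and> (\<forall>j. Polynomial.coeff f j \<in> \<int>) \<and> (\<forall>j>i. Polynomial.coeff f j = 0)}"
      for i :: nat
    have II: "of_nat p * (y + poly f g) \<in> I i"
      if "y \<in> \<O>" "\<forall>j. Polynomial.coeff f j \<in> \<int>" "\<forall>j>i. Polynomial.coeff f j = 0" for y f i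
      using that unfolding I_def by blast
    have "\<exists>i. of_nat p * g ^ Suc i \<in> I i"
    proof (rule ccontr)
      assume no: "\<not> ?thesis"
      have "Suc (nf_degree K) \<le> nf_degree K"
      proof (rule ascending_chain_length_le_degree[OF K prime_int_p, of I _ "\<lambda>i. of_nat p * g ^ Suc i"])
        show "0 \<in> I i" for i using II[OF O_0, of 0 i] by simp
        show "x + y \<in> I i" if "x \<in> I i" "y \<in> I i" for i x y
        proof -
          from that obtain y1 f1 y2 f2 where
            1: "x = of_nat p * (y1 + poly f1 g)" "y1 \<in> \<O>" "\<forall>j. Polynomial.coeff f1 j \<in> \<int>" "\<forall>j>i. Polynomial.coeff f1 j = 0"
            and 2: "y = of_nat p * (y2 + poly f2 g)" "y2 \<in> \<O>" "\<forall>j. Polynomial.coeff f2 j \<in> \<int>" "\<forall>j>i. Polynomial.coeff f2 j = 0"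
            unfolding I_def by blast
          have "x + y = of_nat p * ((y1 + y2) + poly (f1 + f2) g)" by (simp add: 1 2 algebra_simps)
          also have "\<dots> \<in> I i" by (rule II[OF O_add[OF 1(2) 2(2)]]) (use 1 2 in auto)
          finally show ?thesis .
        qed
        show "of_int c * x \<in> I i" if "x \<in> I i" for i x c
        proof -
          from that obtain y f where
            1: "x = of_nat p * (y + poly f g)" "y \<in> \<O>" "\<forall>j. Polynomial.coeff f j \<in> \<int>" "\<forall>j>i. Polynomial.coeff f j = 0"
            unfolding I_def by blast
          have "of_int c * x = of_nat p * ((of_int c * y) + poly (Polynomial.smult (of_int c) f) g)"
            by (simp add: 1 algebra_simps)
          also have "\<dots> \<in> I i" by (rule II[OF O_mult[OF O_of_int 1(2)]]) (use 1 in auto)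
          finally show ?thesis .
        qed
        show "I i \<subseteq> I (Suc i)" for i unfolding I_def using less_trans[OF lessI] by blast
        show "of_nat p * g ^ Suc i \<in> K" for i using gpow P_O by blast
        show "of_nat p * g ^ Suc i \<in> I (Suc i)" for i
          using II[OF O_0, of "Polynomial.monom 1 (Suc i)" "Suc i"] by (simp add: poly_monom coeff_monom)
        show "of_nat p * g ^ Suc i \<notin> I i" for i using no by blast
        \<comment> \<open>The integral part is \<open>p * g ^ Suc i\<close> itself, taken with the
          zero polynomial.\<close>
        show "of_int (int p) * (of_nat p * g ^ Suc i) \<in> I 0" for i
          using II[OF P_O[OF gpow[of "Suc i"]], of 0 0] by simp
      qed
      then show False by simp
    qed
    then obtain i y f where f: "of_nat p * g ^ Suc i = of_nat p * (y + poly f g)" "y \<in> \<O>"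
      "\<forall>j. Polynomial.coeff f j \<in> \<int>" "\<forall>j>i. Polynomial.coeff f j = 0"
      unfolding I_def by blast
    \<comment> \<open>Stationarity says that the monic integer polynomial \<open>h\<close> takes an
      integral value \<open>y\<close> at \<open>g\<close>, so \<open>g\<close> is a root of a monic
      polynomial with integral coefficients.\<close>
    define h where "h = Polynomial.monom 1 (Suc i) - f"
    have deg: "Polynomial.degree h = Suc i"
      by (intro antisym degree_le le_degree) (use f in \<open>auto simp: h_def coeff_monom\<close>)
    have "algebraic_int g"
    proof (rule algebraic_int_root)
      show "algebraic_int y" using f by simp
      show "poly h g = y" using f(1) p_nonzero by (simp add: h_def poly_monom)
      show "\<forall>i. Polynomial.coeff h i \<in> \<int>" using f by (simp add: h_def coeff_monom)
      show "Polynomial.lead_coeff h = 1" using f by (simp add: deg) (simp add: h_def coeff_monom)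
      show "Polynomial.degree h > 0" by (simp add: deg)
    qed
    then show False using gO gK by simp
  qed
  then obtain x where x: "x \<in> P" "g * x \<notin> P" by blast
  show ?thesis
  proof (rule that[of "g * x" x])
    fix y assume "y \<in> P"
    then show "\<exists>z\<in>\<O>. g * x * y = x * z"
      by (intro bexI[of _ "g * y"] gP) (simp add: mult_ac)
  qed (fact gP[OF x(1)] x)+
qed

end

section \<open>Valuations\<close>

text \<open>In the localization at \<open>P\<close>, where \<open>w\<close> is a unit,
  \<open>v\<close> generates the maximal ideal. One denominator \<open>w\<close> serves for all
  elements of \<open>P\<close>.\<close>

locale nf_uniformizer = nf_prime +
  fixes w v
  assumes w: "w \<in> \<O>" "w \<notin> P" and v: "v \<in> P" and wv: "\<And>x. x \<in> P \<Longrightarrow> \<exists>y\<in>\<O>. w * x = v * y"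
begin

section \<open>Powers of \<open>P\<close> described by the uniformizer\<close>

abbreviation Ppow where "Ppow n \<equiv> P [^]\<^bsub>ideals_set (int_ring K)\<^esub> (n::nat)"

lemma Ppow_0: "Ppow 0 = \<O>"
  by (simp add: ideals_set_def)

lemma Ppow_Suc: "Ppow (Suc n) = ideal_prod (int_ring K) (Ppow n) P"
  by (simp add: nat_pow_def ideals_set_def)

lemma Ppow_ideal: "ideal (Ppow n) (int_ring K)"
proof (induction n)
  case 0
  then show ?case using OK.oneideal Ppow_0 by simp
next
  case (Suc n)
  then show ?case unfolding Ppow_Suc using ideal_P by (rule OK.ideal_prod_is_ideal)
qed

lemma power_in_Ppow: "x \<in> P \<Longrightarrow> x ^ n \<in> Ppow n"
proof (induction n)
  case 0
  then show ?case using O_1 Ppow_0 by simp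
next
  case (Suc n)
  then have "x ^ n \<otimes>\<^bsub>int_ring K\<^esub> x \<in> Ppow (Suc n)" unfolding Ppow_Suc by (intro ideal_prod.prod)
  then show ?case by (simp add: mult.commute)
qed

text \<open>A product of \<open>n\<close> elements of \<open>P\<close> acquires one factor
  \<open>v\<close> for each factor \<open>w\<close>; this passes to sums of such products because
  the denominator \<open>w ^ n\<close> is common.\<close>

lemma Ppow_imp:
  "x \<in> Ppow n \<Longrightarrow> \<exists>y\<in>\<O>. w ^ n * x = v ^ n * y"
proof (induction n arbitrary: x)
  case 0
  then show ?case using Ppow_0 by auto
next
  case (Suc n)
  from Suc.prems have "x \<in> ideal_prod (int_ring K) (Ppow n) P" by (simp only: Ppow_Suc)
  then show ?case
  proof (induction x rule: ideal_prod.induct)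
    case (prod i j)
    obtain y z where "y \<in> \<O>" "w ^ n * i = v ^ n * y" "z \<in> \<O>" "w * j = v * z"
      using Suc.IH[OF prod(1)] wv[OF prod(2)] by blast
    then show ?case
      by (intro bexI[OF _ O_mult[of y z]]) (auto simp: mult_ac, metis mult.assoc mult.left_commute)
  next
    case (sum s t)
    then obtain y z where "y \<in> \<O>" "w ^ Suc n * s = v ^ Suc n * y" "z \<in> \<O>" "w ^ Suc n * t = v ^ Suc n * z"
      by blast
    then show ?case
      by (intro bexI[OF _ O_add[of y z]]) (auto simp: distrib_left)
  qed
qed

text \<open>An \<open>s\<close> outside \<open>P\<close> is invertible modulo every power of
  \<open>P\<close>: if \<open>z = 1 - s * t\<close> lies in \<open>P\<close>, the geometric series
  yields \<open>s * t * (1 + z + ... + z ^ (n - 1)) = 1 - z ^ n\<close>.\<close>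

lemma Ppow_cancel:
  assumes s: "s \<in> \<O>" "s \<notin> P" and x: "x \<in> \<O>" "s * x \<in> Ppow n"
  shows "x \<in> Ppow n"
proof -
  obtain t where t: "t \<in> \<O>" "1 - s * t \<in> P" using P_maximal[OF s] .
  define z where "z = 1 - s * t"
  have zP: "z \<in> P" using t by (simp add: z_def)
  have zO: "z \<in> \<O>" using P_O zP by blast
  have sumO: "(\<Sum>i<n. z ^ i) \<in> \<O>"
    by (induction n) (use O_0 O_add O_power[OF zO] in auto)
  have "1 - z ^ n = (1 - z) * (\<Sum>i<n. z ^ i)" by (simp add: one_diff_power_eq)
  then have "x * (1 - z ^ n) = x * ((s * t) * (\<Sum>i<n. z ^ i))" by (simp add: z_def)
  then have "x = (t * (\<Sum>i<n. z ^ i)) * (s * x) + x * z ^ n"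
    by (simp add: algebra_simps)
  moreover have "(t * (\<Sum>i<n. z ^ i)) * (s * x) + x * z ^ n \<in> Ppow n"
    using ideal_add[OF Ppow_ideal ideal_mult[OF Ppow_ideal x(2) O_mult[OF t(1) sumO]]
      ideal_mult[OF Ppow_ideal power_in_Ppow[OF zP] x(1)]] .
  ultimately show ?thesis by simp
qed

text \<open>In other words, \<open>P^n\<close> is the contraction of the ideal generated by
  \<open>v ^ n\<close> in the localization at \<open>P\<close>.\<close>

lemma in_Ppow_iff:
  assumes x: "x \<in> \<O>"
  shows "x \<in> Ppow n \<longleftrightarrow> (\<exists>s\<in>\<O>. s \<notin> P \<and> (\<exists>y\<in>\<O>. s * x = v ^ n * y))"
proof
  assume "x \<in> Ppow n"
  from Ppow_imp[OF this] show "\<exists>s\<in>\<O>. s \<notin> P \<and> (\<exists>y\<in>\<O>. s * x = v ^ n * y)"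
    using O_power[OF w(1), of n] P_power[OF w(1), of n] w(2) by blast
next
  assume "\<exists>s\<in>\<O>. s \<notin> P \<and> (\<exists>y\<in>\<O>. s * x = v ^ n * y)"
  then obtain s y where s: "s \<in> \<O>" "s \<notin> P" "y \<in> \<O>" "s * x = v ^ n * y" by blast
  have "y * v ^ n \<in> Ppow n" using ideal_mult[OF Ppow_ideal power_in_Ppow[OF v] s(3)] .
  then show "x \<in> Ppow n" using Ppow_cancel[OF s(1,2) x] s(4) by (simp add: mult.commute)
qed

lemma v_nonzero: "v \<noteq> 0"
proof
  assume "v = 0"
  then have "w * x = 0" if "x \<in> P" for x using wv[OF that] by auto
  from this[OF p_in_P] have "w = 0" using p_nonzero by simp
  then show False using w P_0 by simp
qed

text \<open>\<open>exact n x\<close> says that \<open>x\<close> is \<open>v ^ n\<close> times a unit of the localization at \<open>P\<close>.\<close>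

definition exact :: "nat \<Rightarrow> 'a \<Rightarrow> bool" where
  "exact n x \<longleftrightarrow> (\<exists>s\<in>\<O>. s \<notin> P \<and> (\<exists>y\<in>\<O>. y \<notin> P \<and> s * x = v ^ n * y))"

lemma exact_mult:
  assumes "exact m x" "exact n y" shows "exact (m + n) (x * y)"
proof -
  from assms obtain s a t b where s: "s \<in> \<O>" "s \<notin> P" "a \<in> \<O>" "a \<notin> P" "s * x = v ^ m * a"
    and t: "t \<in> \<O>" "t \<notin> P" "b \<in> \<O>" "b \<notin> P" "t * y = v ^ n * b" unfolding exact_def by blast
  have "s * t \<in> \<O>" "a * b \<in> \<O>" "s * t \<notin> P" "a * b \<notin> P"
    using O_mult s t P_prime by blast+
  moreover have "(s * t) * (x * y) = (s * x) * (t * y)" by (simp add: mult_ac)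
  then have "(s * t) * (x * y) = v ^ (m + n) * (a * b)"
    by (simp add: s t power_add mult_ac)
  ultimately show ?thesis unfolding exact_def by blast
qed

lemma exact_power: "exact m x \<Longrightarrow> exact (m * k) (x ^ k)"
proof (induction k)
  case 0
  then show ?case using O_1 P_1 by (auto simp: exact_def)
next
  case (Suc k)
  then show ?case using exact_mult[of m x "m * k" "x ^ k"] by (simp add: algebra_simps)
qed

text \<open>If \<open>m > n\<close>, comparing the two representations of \<open>x\<close> and
  cancelling \<open>v ^ n\<close> leaves a factor \<open>v\<close> in a product of two elements
  outside \<open>P\<close>.\<close>

lemma exact_in_Ppow:
  assumes x: "x \<in> \<O>" and e: "exact n x"
  shows "x \<in> Ppow m \<longleftrightarrow> m \<le> n"
proof -
  obtain s a where s: "s \<in> \<O>" "s \<notin> P" "a \<in> \<O>" "a \<notin> P" "s * x = v ^ n * a"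
    using e unfolding exact_def by blast
  have vO: "v \<in> \<O>" using P_O v by blast
  show ?thesis
  proof
    assume "m \<le> n"
    then have "s * x = v ^ m * (v ^ (n - m) * a)" using s(5) by (simp flip: mult.assoc power_add)
    then show "x \<in> Ppow m" unfolding in_Ppow_iff[OF x]
      using s(1,2) O_mult[OF O_power[OF vO] s(3)] by blast
  next
    assume "x \<in> Ppow m"
    then obtain t b where t: "t \<in> \<O>" "t \<notin> P" "b \<in> \<O>" "t * x = v ^ m * b"
      unfolding in_Ppow_iff[OF x] by blast
    show "m \<le> n"
    proof (rule ccontr)
      assume "\<not> m \<le> n"
      then have "v ^ m = v ^ n * v * v ^ (m - n - 1)"
        by (metis Suc_diff_Suc diff_Suc_1 le_add_diff_inverse linorder_not_le mult.assoc nat_le_linear power_Suc power_add diff_diff_left plus_1_eq_Suc add.commute)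
      moreover have "v ^ n * (t * a) = v ^ m * (s * b)"
        using s(5) t(4) by (metis mult.assoc mult.commute)
      ultimately have "v ^ n * (t * a) = v ^ n * ((v ^ (m - n - 1) * (s * b)) * v)" by (simp add: mult_ac)
      then have "t * a = (v ^ (m - n - 1) * (s * b)) * v" using v_nonzero by simp
      also have "\<dots> \<in> P" using P_mult[OF v O_mult[OF O_power[OF vO] O_mult[OF s(1) t(3)]]] .
      finally show False using P_prime[OF t(1) s(3)] t(2) s(4) by blast
    qed
  qed
qed

text \<open>If the cofactor \<open>a\<close> of \<open>v ^ n\<close> were in \<open>P\<close>,
  multiplication by \<open>w\<close> would extract one more \<open>v\<close>.\<close>

lemma exactI:
  assumes x: "x \<in> \<O>" "x \<in> Ppow n" "x \<notin> Ppow (Suc n)"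
  shows "exact n x"
proof -
  obtain s a where s: "s \<in> \<O>" "s \<notin> P" "a \<in> \<O>" "s * x = v ^ n * a"
    using x(2) unfolding in_Ppow_iff[OF x(1)] by blast
  have "a \<notin> P"
  proof
    assume "a \<in> P"
    then obtain b where b: "b \<in> \<O>" "w * a = v * b" using wv by blast
    have "(w * s) * x = v ^ n * (w * a)" using s(4) by (simp add: mult_ac)
    also have "\<dots> = v ^ Suc n * b" by (simp add: b(2))
    finally have "x \<in> Ppow (Suc n)" unfolding in_Ppow_iff[OF x(1)]
      using O_mult[OF w(1) s(1)] P_prime[OF w(1) s(1)] w(2) s(2) b(1) by blast
    then show False using x(3) by blast
  qed
  then show ?thesis using s unfolding exact_def by blast
qed

section \<open>Existence of finite orders and the bound for the ramification index\<close>

lemma exact_ord_int: "x \<in> \<O> \<Longrightarrow> exact n x \<Longrightarrow> ord_int K P x = n"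
  unfolding ord_int_def using exact_in_Ppow by (intro Greatest_equality) auto

lemma exact_v: "exact n (v ^ n)"
  unfolding exact_def using O_1 P_1 by (intro bexI[of _ 1]) auto

lemma Ppow_antimono: "m \<le> n \<Longrightarrow> Ppow n \<subseteq> Ppow m"
proof
  fix x assume mn: "m \<le> n" and x: "x \<in> Ppow n"
  have xO: "x \<in> \<O>" using ideal_O[OF Ppow_ideal x] .
  obtain s y where s: "s \<in> \<O>" "s \<notin> P" "y \<in> \<O>" "s * x = v ^ n * y"
    using x unfolding in_Ppow_iff[OF xO] by blast
  have "s * x = v ^ m * (v ^ (n - m) * y)" using s(4) mn by (simp flip: mult.assoc power_add)
  then show "x \<in> Ppow m" unfolding in_Ppow_iff[OF xO]
    using s(1,2) O_mult[OF O_power[OF P_O[OF v]] s(3)] by blast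
qed

text \<open>The powers of \<open>P\<close> up to \<open>e\<close> form a descending chain separated
  by the powers of \<open>v\<close>, and \<open>P^e\<close> contains all multiples of
  \<open>p\<close>.\<close>

lemma p_in_Ppow_le:
  assumes "of_nat p \<in> Ppow e"
  shows "e \<le> nf_degree K"
proof (rule chain_length_le_degree[OF K prime_int_p, of Ppow e "\<lambda>i. v ^ i"])
  have vO: "v ^ i \<in> \<O>" for i using O_power[OF P_O[OF v]] by blast
  show "v ^ i \<in> K" for i using vO by blast
  show "v ^ i \<in> Ppow i" for i by (rule power_in_Ppow[OF v])
  show "v ^ i \<notin> Ppow (Suc i)" for i using exact_in_Ppow[OF vO exact_v, of i "Suc i"] by simp
  show "of_int (int p) * v ^ i \<in> Ppow e" for i
    using ideal_mult[OF Ppow_ideal assms vO] by (simp add: mult.commute)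
qed (use ideal_0 ideal_add ideal_mult[OF _ _ O_of_int] Ppow_ideal Ppow_antimono in auto)

text \<open>This \<open>e\<close> is the ramification index; the chain bound makes the greatest
  exponent exist.\<close>

lemma ex_exact_p: "\<exists>e. 1 \<le> e \<and> e \<le> nf_degree K \<and> exact e (of_nat p)"
proof -
  define e where "e = (GREATEST e. of_nat p \<in> Ppow e)"
  have "of_nat p \<in> Ppow 1" using power_in_Ppow[OF p_in_P, of 1] by simp
  then have 1: "of_nat p \<in> Ppow e" "1 \<le> e"
    unfolding e_def using p_in_Ppow_le GreatestI_nat[of "\<lambda>e. of_nat p \<in> Ppow e" 1] Greatest_le_nat[of "\<lambda>e. of_nat p \<in> Ppow e" 1]
    by blast+
  have "of_nat p \<notin> Ppow (Suc e)"
    using Greatest_le_nat[of "\<lambda>e. of_nat p \<in> Ppow e" "Suc e" "nf_degree K", folded e_def] p_in_Ppow_le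
    by (metis Suc_n_not_le_n)
  then have "exact e (of_nat p)" using exactI[OF O_of_nat 1(1)] by blast
  then show ?thesis using 1 p_in_Ppow_le by blast
qed

lemma exact_unit: "x \<in> \<O> \<Longrightarrow> x \<notin> P \<Longrightarrow> exact 0 x"
  unfolding exact_def using O_1 P_1 by (intro bexI[of _ 1]) auto

text \<open>Splitting off the power of \<open>p\<close> in \<open>m\<close> leaves an integer
  outside \<open>P\<close>, which has order 0.\<close>

lemma ex_exact_int: "m \<noteq> 0 \<Longrightarrow> \<exists>n. exact n (of_int m)"
proof -
  assume m: "m \<noteq> 0"
  define k where "k = multiplicity (int p) m"
  have np: "\<not> is_unit (int p)" using prime_int_p not_prime_unit by blast
  obtain m' where m': "m = int p ^ k * m'" "\<not> int p dvd m'"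
    using multiplicity_decompose'[OF m np] unfolding k_def by blast
  obtain e where e: "exact e (of_nat p)" using ex_exact_p by blast
  have "exact (e * k + 0) (of_nat p ^ k * of_int m')"
    by (intro exact_mult exact_power e exact_unit O_of_int) (use m' of_int_in_P in auto)
  then show ?thesis using m' by auto
qed

text \<open>Since \<open>x\<close> divides a nonzero integer, the order of that integer bounds every
  \<open>k\<close> with \<open>x \<in> P^k\<close>.\<close>

lemma ex_exact:
  assumes x: "x \<in> \<O>" "x \<noteq> 0"
  shows "\<exists>n. exact n x"
proof -
  obtain m y where m: "m \<noteq> 0" "y \<in> \<O>" "x * y = of_int m" using divides_int[OF x] .
  obtain n where n: "exact n (of_int m)" using ex_exact_int[OF m(1)] by blast
  have bound: "k \<le> n" if "x \<in> Ppow k" for k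
  proof -
    have "y * x \<in> Ppow k" using ideal_mult[OF Ppow_ideal that m(2)] .
    then have "of_int m \<in> Ppow k" using m(3) by (simp add: mult.commute)
    then show ?thesis using exact_in_Ppow[OF O_of_int n] by blast
  qed
  define k where "k = (GREATEST k. x \<in> Ppow k)"
  have "x \<in> Ppow k"
    unfolding k_def using bound x(1) Ppow_0 GreatestI_nat[of "\<lambda>k. x \<in> Ppow k" 0 n] by blast
  moreover have "x \<notin> Ppow (Suc k)"
    using Greatest_le_nat[of "\<lambda>e. x \<in> Ppow e" "Suc k" n, folded k_def] bound by (metis Suc_n_not_le_n)
  ultimately show ?thesis using exactI[OF x(1)] by blast
qed

lemma ord_int_exact: "x \<in> \<O> \<Longrightarrow> x \<noteq> 0 \<Longrightarrow> exact (ord_int K P x) x"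
  using ex_exact exact_ord_int by metis

end

section \<open>Additivity of orders and valuations, free of the auxiliary \<open>w\<close> and
  \<open>v\<close>\<close>

context nf_prime
begin

lemma ex_nf_uniformizer: "\<exists>w v. nf_uniformizer K P w v"
proof (rule ex_uniformizer)
  fix w v assume "w \<in> \<O>" "w \<notin> P" "v \<in> P" "\<And>x. x \<in> P \<Longrightarrow> \<exists>y\<in>\<O>. w * x = v * y"
  then have "nf_uniformizer K P w v" by unfold_locales
  then show ?thesis by blast
qed

lemma ord_int_mult:
  assumes "x \<in> \<O>" "x \<noteq> 0" "y \<in> \<O>" "y \<noteq> 0"
  shows "ord_int K P (x * y) = ord_int K P x + ord_int K P y"
proof -
  obtain w v where "nf_uniformizer K P w v" using ex_nf_uniformizer by blast
  then interpret nf_uniformizer K P w v .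
  show ?thesis using exact_ord_int[OF O_mult[OF assms(1,3)]] exact_mult ord_int_exact assms by blast
qed

lemma ord_int_unit:
  assumes "x \<in> \<O>" "x \<notin> P" shows "ord_int K P x = 0"
proof -
  obtain w v where "nf_uniformizer K P w v" using ex_nf_uniformizer by blast
  then interpret nf_uniformizer K P w v .
  show ?thesis using exact_ord_int exact_unit assms by blast
qed

lemma ord_int_p: "1 \<le> ord_int K P (of_nat p)" "ord_int K P (of_nat p) \<le> nf_degree K"
proof -
  obtain w v where "nf_uniformizer K P w v" using ex_nf_uniformizer by blast
  then interpret nf_uniformizer K P w v .
  show "1 \<le> ord_int K P (of_nat p)" "ord_int K P (of_nat p) \<le> nf_degree K"
    using ex_exact_p exact_ord_int[OF O_of_nat] by blast+
qed

text \<open>Cross multiplication and additivity of \<open>ord_int\<close> make the difference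
  independent of the fraction, so the \<open>THE\<close> in \<open>ord_frac\<close> denotes.\<close>

lemma ord_frac_divide:
  assumes a: "a \<in> \<O>" "a \<noteq> 0" and b: "b \<in> \<O>" "b \<noteq> 0"
  shows "ord_frac K P (a / b) = int (ord_int K P a) - int (ord_int K P b)"
  unfolding ord_frac_def
proof (rule the_equality)
  show "\<exists>c\<in>carrier (int_ring K) - {0}. \<exists>d\<in>carrier (int_ring K) - {0}. a / b = c / d \<and>
    int (ord_int K P a) - int (ord_int K P b) = int (ord_int K P c) - int (ord_int K P d)"
    using a b by auto
next
  fix k assume "\<exists>c\<in>carrier (int_ring K) - {0}. \<exists>d\<in>carrier (int_ring K) - {0}. a / b = c / d \<and>
    k = int (ord_int K P c) - int (ord_int K P d)"
  then obtain c d where c: "c \<in> \<O>" "c \<noteq> 0" and d: "d \<in> \<O>" "d \<noteq> 0" and eq: "a / b = c / d"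
    and k: "k = int (ord_int K P c) - int (ord_int K P d)" by auto
  have "a * d = c * b" using eq b d by (simp add: field_simps)
  then have "ord_int K P a + ord_int K P d = ord_int K P c + ord_int K P b"
    using ord_int_mult[OF a d] ord_int_mult[OF c b] by simp
  then show "k = int (ord_int K P a) - int (ord_int K P b)" using k by linarith
qed

lemma ex_fraction:
  assumes x: "x \<in> K" "x \<noteq> 0"
  obtains a b where "a \<in> \<O>" "a \<noteq> 0" "b \<in> \<O>" "b \<noteq> 0" "x = a / b"
proof -
  obtain m where m: "m \<noteq> 0" "algebraic_int (of_int m * x)"
    using number_field_integral_multiple[OF K x(1)] .
  show ?thesis
    by (rule that[of "of_int m * x" "of_int m"])
      (use m x O_of_int[of m] subfield_mult[OF K_sub subfield_of_int[OF K_sub] x(1)] in auto)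
qed

lemma ord_frac_mult:
  assumes x: "x \<in> K" "x \<noteq> 0" and y: "y \<in> K" "y \<noteq> 0"
  shows "ord_frac K P (x * y) = ord_frac K P x + ord_frac K P y"
proof -
  obtain a b where a: "a \<in> \<O>" "a \<noteq> 0" and b: "b \<in> \<O>" "b \<noteq> 0" and x': "x = a / b" using ex_fraction[OF x] .
  obtain c d where c: "c \<in> \<O>" "c \<noteq> 0" and d: "d \<in> \<O>" "d \<noteq> 0" and y': "y = c / d" using ex_fraction[OF y] .
  have "x * y = (a * c) / (b * d)" using x' y' by simp
  then have "ord_frac K P (x * y) = int (ord_int K P (a * c)) - int (ord_int K P (b * d))"
    using ord_frac_divide[OF O_mult[OF a(1) c(1)] _ O_mult[OF b(1) d(1)]] a b c d by simp
  then show ?thesis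
    using ord_frac_divide[OF a b] ord_frac_divide[OF c d] ord_int_mult[OF a c] ord_int_mult[OF b d] x' y'
    by simp
qed

lemma ord_frac_integral:
  assumes a: "a \<in> \<O>" "a \<noteq> 0"
  shows "ord_frac K P a = int (ord_int K P a)"
  using ord_frac_divide[OF a O_1] ord_int_unit[OF O_1 P_1] by simp

lemma ord_frac_p: "1 \<le> ord_frac K P (of_nat p)" "ord_frac K P (of_nat p) \<le> int (nf_degree K)"
  using ord_int_p ord_frac_integral[OF O_of_nat p_nonzero] by auto

lemma val_eq: "val K P x = of_int (ord_frac K P x) / of_int (ord_frac K P (of_nat p))"
  by (simp add: val_def p_def)

lemma val_mult:
  assumes "x \<in> K" "x \<noteq> 0" "y \<in> K" "y \<noteq> 0"
  shows "val K P (x * y) = val K P x + val K P y"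
  by (simp add: val_eq ord_frac_mult[OF assms] add_divide_distrib)

lemma val_integral_nonneg:
  assumes "a \<in> \<O>" "a \<noteq> 0" shows "val K P a \<ge> 0"
  using ord_frac_p(1) by (simp add: val_eq ord_frac_integral[OF assms])

lemma val_of_int_coprime:
  assumes "\<not> int p dvd c" shows "val K P (of_int c) = 0"
proof -
  have "of_int c \<notin> P" using assms of_int_in_P by blast
  moreover have "of_int c \<noteq> (0::'a)" using assms by auto
  ultimately show ?thesis
    using ord_int_unit[OF O_of_int, of c] ord_frac_integral[OF O_of_int, of c] by (simp add: val_eq)
qed

end

section \<open>The number of primes over a rational prime\<close>

text \<open>An element of \<open>Q'\<close> outside \<open>Q\<close> is invertible modulo
  \<open>Q\<close>, which would give \<open>1 \<in> Q'\<close>.\<close>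

lemma nonzero_primes_incomparable:
  assumes L: "number_field L" and Q: "Q \<in> nonzero_primes L" "Q' \<in> nonzero_primes L" "Q \<subseteq> Q'"
  shows "Q = Q'"
proof (rule ccontr)
  interpret Q: nf_prime L Q by unfold_locales (use L Q in auto)
  interpret Q': nf_prime L Q' by unfold_locales (use L Q in auto)
  assume "Q \<noteq> Q'"
  then obtain a where a: "a \<in> Q'" "a \<notin> Q" using Q(3) by blast
  obtain b where b: "b \<in> Q.\<O>" "1 - a * b \<in> Q" using Q.P_maximal[OF Q'.P_O[OF a(1)] a(2)] .
  have "1 - a * b + b * a \<in> Q'" using Q'.P_add[of "1 - a * b"] Q'.P_mult[OF a(1) b(1)] b(2) Q(3) by blast
  then show False using Q'.P_1 by (simp add: mult.commute)
qed

text \<open>Intersecting the primes over \<open>q\<close> one after the other gives a descending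
  chain. It is strict because no prime contains another, and its last member contains the
  \<open>q\<close>-multiples of integral elements.\<close>

lemma num_primes_over_le_degree:
  fixes L :: "'a::field_char_0 set"
  assumes L: "number_field L"
  shows "num_primes_over q L \<le> nf_degree L"
proof (cases "num_primes_over q L = 0")
  \<comment> \<open>An infinite set has \<open>card\<close> 0, so this case comes with
    finiteness.\<close>
  case False
  define S where "S = {Q \<in> nonzero_primes L. lies_over_nat Q q}"
  define g where "g = num_primes_over q L"
  have card: "card S = g" by (simp add: S_def g_def num_primes_over_def)
  then have fin: "finite S" "S \<noteq> {}" using False by (auto simp: g_def intro: card_ge_0_finite)
  obtain Q where bij: "bij_betw Q {..<g} S"
    using ex_bij_betw_nat_finite[OF fin(1)] card by (auto simp: atLeast0LessThan)
  have QS: "Q i \<in> S" if "i < g" for i using bij that by (auto simp: bij_betw_def)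
  have prm: "nf_prime L (Q i)" if "i < g" for i using QS[OF that] L by (simp add: S_def nf_prime_def)
  have over: "lies_over_nat (Q i) q" if "i < g" for i using QS[OF that] by (simp add: S_def)
  define OL where "OL = {x \<in> L. algebraic_int x}"
  \<comment> \<open>The cutoff \<open>min i g\<close> makes the chain constant from \<open>g\<close>
    on: the subgroup conditions are required at every index, but \<open>Q j\<close> is known to be
    an ideal only for \<open>j < g\<close>.\<close>
  define I where "I i = {x \<in> OL. \<forall>j<min i g. x \<in> Q j}" for i
  have g0: "g > 0" using False by (simp add: g_def)
  interpret Q0: nf_prime L "Q 0" by (rule prm[OF g0])
  have qprime: "Factorial_Ring.prime (int q)" using over[OF g0] by (simp add: lies_over_nat_def)
  have "\<exists>x. x \<in> I i \<and> x \<notin> Q i" if i: "i < g" for i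
  proof -
    interpret Qi: nf_prime L "Q i" by (rule prm[OF i])
    \<comment> \<open>The witness is a product of elements taken from each \<open>Q j\<close>
      outside \<open>Q i\<close>; it avoids \<open>Q i\<close> because that ideal is prime.\<close>
    have "\<exists>x\<in>OL. (\<forall>j<k. x \<in> Q j) \<and> x \<notin> Q i" if "k \<le> i" for k
      using that
    proof (induction k)
      case 0
      then show ?case using Q0.O_1 Qi.P_1 by (auto simp: OL_def)
    next
      case (Suc k)
      then obtain x where x: "x \<in> OL" "\<forall>j<k. x \<in> Q j" "x \<notin> Q i" by auto
      have k: "k < g" using Suc i by simp
      interpret Qk: nf_prime L "Q k" by (rule prm[OF k])
      have "Q k \<noteq> Q i" using bij k i Suc.prems unfolding bij_betw_def inj_on_def by (metis Suc_n_not_le_n lessThan_iff)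
      then have "\<not> Q k \<subseteq> Q i" using nonzero_primes_incomparable[OF L] QS[OF k] QS[OF i] by (auto simp: S_def)
      then obtain y where y: "y \<in> Q k" "y \<notin> Q i" by blast
      have yO: "y \<in> OL" using Qk.P_O[OF y(1)] by (simp add: OL_def)
      have "x * y \<in> Q j" if "j < Suc k" for j
      proof (cases "j = k")
        case True
        then show ?thesis using Qk.P_mult[OF y(1)] x(1) by (simp add: OL_def)
      next
        case False
        then have j: "j < k" using that by simp
        interpret Qj: nf_prime L "Q j" by (rule prm) (use j k in simp)
        show ?thesis using Qj.P_mult[of x y] x(2) j yO by (simp add: OL_def mult.commute)
      qed
      moreover have "x * y \<notin> Q i" using Qi.P_prime[of x y] x(1,3) y(2) yO unfolding OL_def by blast
      moreover have "x * y \<in> OL" using Q0.O_mult[of x y] x(1) yO unfolding OL_def by blast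
      ultimately show ?case by blast
    qed
    from this[of i] i show ?thesis by (auto simp: I_def)
  qed
  then obtain a where a: "\<And>i. i < g \<Longrightarrow> a i \<in> I i" "\<And>i. i < g \<Longrightarrow> a i \<notin> Q i" by metis
  have "g \<le> nf_degree L"
  proof (rule chain_length_le_degree[OF L qprime, of I g a])
    show "0 \<in> I i" for i using Q0.O_0 nf_prime.P_0[OF prm] by (auto simp: I_def OL_def)
    show "x + y \<in> I i" if "x \<in> I i" "y \<in> I i" for i x y
      using that Q0.O_add nf_prime.P_add[OF prm] unfolding I_def OL_def by auto
    show "of_int c * x \<in> I i" if "x \<in> I i" for i x c
      using that Q0.O_mult[OF Q0.O_of_int] nf_prime.P_mult[OF prm _ Q0.O_of_int] unfolding I_def OL_def by auto
    show "I j \<subseteq> I i" if "i \<le> j" for i j using that unfolding I_def by auto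
    show "a i \<in> L" if "i < g" for i using a(1)[OF that] by (simp add: I_def OL_def)
    show "a i \<in> I i" if "i < g" for i by (rule a(1)[OF that])
    show "a i \<notin> I (Suc i)" if "i < g" for i using a(2)[OF that] that by (auto simp: I_def)
    show "of_int (int q) * a i \<in> I g" if i: "i < g" for i
    proof -
      have aO: "a i \<in> Q0.\<O>" using a(1)[OF i] by (simp add: I_def OL_def)
      have "a i * of_int (int q) \<in> Q j" if j: "j < g" for j
        by (rule nf_prime.P_mult[OF prm[OF j] _ aO]) (simp only: nf_prime.lies_over_natD(2)[OF prm[OF j] over[OF j]], simp)
      then show ?thesis using Q0.O_mult[OF aO Q0.O_of_int[of "int q"]] by (auto simp: I_def OL_def mult.commute)
    qed
  qed
  then show ?thesis by (simp add: g_def)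
qed simp

section \<open>Existence of a Galois closure\<close>

definition coeffs_in :: "'b::zero set \<Rightarrow> 'b poly \<Rightarrow> bool" where
  "coeffs_in E p \<longleftrightarrow> (\<forall>i. Polynomial.coeff p i \<in> E)"

text \<open>Homomorphisms are total functions constrained only on the subring \<open>E\<close>, so
  extending one just means agreeing with it on \<open>E\<close>.\<close>

locale hom_on =
  fixes E :: "'b::comm_ring_1 set" and \<sigma> :: "'b \<Rightarrow> 'a::comm_ring_1"
  assumes one: "1 \<in> E" and add: "x \<in> E \<Longrightarrow> y \<in> E \<Longrightarrow> x + y \<in> E"
    and mult: "x \<in> E \<Longrightarrow> y \<in> E \<Longrightarrow> x * y \<in> E" and minus: "x \<in> E \<Longrightarrow> - x \<in> E"
    and hom_one: "\<sigma> 1 = 1"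
    and hom_add: "x \<in> E \<Longrightarrow> y \<in> E \<Longrightarrow> \<sigma> (x + y) = \<sigma> x + \<sigma> y"
    and hom_mult: "x \<in> E \<Longrightarrow> y \<in> E \<Longrightarrow> \<sigma> (x * y) = \<sigma> x * \<sigma> y"
begin

lemma zero: "0 \<in> E"
  using add[OF one minus[OF one]] by simp

lemma hom_zero [simp]: "\<sigma> 0 = 0"
  using hom_add[OF zero zero] by simp

lemma hom_minus: "x \<in> E \<Longrightarrow> \<sigma> (- x) = - \<sigma> x"
  using hom_add[of x "- x"] minus[of x] by (simp add: add_eq_0_iff)

lemma sum_closed: "(\<And>i. i \<in> A \<Longrightarrow> f i \<in> E) \<Longrightarrow> sum f A \<in> E"
  by (induction A rule: infinite_finite_induct) (auto intro: zero add)

lemma hom_sum: "(\<And>i. i \<in> A \<Longrightarrow> f i \<in> E) \<Longrightarrow> \<sigma> (sum f A) = (\<Sum>i\<in>A. \<sigma> (f i))"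
  by (induction A rule: infinite_finite_induct) (auto simp: hom_add sum_closed)

lemma coeffs_in_add: "coeffs_in E p \<Longrightarrow> coeffs_in E q \<Longrightarrow> coeffs_in E (p + q)"
  by (auto simp: coeffs_in_def intro: add)

lemma coeffs_in_minus: "coeffs_in E p \<Longrightarrow> coeffs_in E (- p)"
  by (auto simp: coeffs_in_def intro: minus)

lemma coeffs_in_mult: "coeffs_in E p \<Longrightarrow> coeffs_in E q \<Longrightarrow> coeffs_in E (p * q)"
  by (auto simp: coeffs_in_def coeff_mult intro!: sum_closed mult)

lemma coeffs_in_pCons: "coeffs_in E (pCons a p) \<longleftrightarrow> a \<in> E \<and> coeffs_in E p"
  unfolding coeffs_in_def by (metis coeff_pCons_0 coeff_pCons_Suc not0_implies_Suc)

lemma coeffs_in_monom: "a \<in> E \<Longrightarrow> coeffs_in E (Polynomial.monom a n)"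
  by (auto simp: coeffs_in_def coeff_monom intro: zero)

lemma map_poly_add:
  "coeffs_in E p \<Longrightarrow> coeffs_in E q \<Longrightarrow> map_poly \<sigma> (p + q) = map_poly \<sigma> p + map_poly \<sigma> q"
  by (intro poly_eqI) (simp add: coeff_map_poly coeffs_in_def hom_add)

lemma map_poly_minus: "coeffs_in E p \<Longrightarrow> map_poly \<sigma> (- p) = - map_poly \<sigma> p"
  by (intro poly_eqI) (simp add: coeff_map_poly coeffs_in_def hom_minus)

lemma map_poly_mult:
  "coeffs_in E p \<Longrightarrow> coeffs_in E q \<Longrightarrow> map_poly \<sigma> (p * q) = map_poly \<sigma> p * map_poly \<sigma> q"
  by (intro poly_eqI) (simp add: coeff_map_poly coeffs_in_def coeff_mult hom_sum mult hom_mult)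

lemma poly_closed: "coeffs_in E p \<Longrightarrow> x \<in> E \<Longrightarrow> poly p x \<in> E"
  by (induction p) (auto simp: coeffs_in_pCons intro: zero add mult)

lemma hom_poly: "coeffs_in E p \<Longrightarrow> x \<in> E \<Longrightarrow> \<sigma> (poly p x) = poly (map_poly \<sigma> p) (\<sigma> x)"
  by (induction p) (auto simp: coeffs_in_pCons map_poly_pCons hom_add hom_mult mult poly_closed)

end

text \<open>The inductive rules of \<open>simple_extension\<close> are the steps of Horner's
  scheme.\<close>

lemma simple_extension_eq_poly:
  "0 \<in> E \<Longrightarrow> ring.simple_extension R\<^sub>0 E r = {poly p r | p. coeffs_in E p}"
proof (intro equalityI subsetI)
  interpret field R\<^sub>0 by (rule type_ring_field)
  assume E: "0 \<in> E"
  {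
    fix z assume "z \<in> simple_extension E r"
    then show "z \<in> {poly p r | p. coeffs_in E p}"
    proof (induction rule: simple_extension.induct)
      case zero
      then show ?case using E by (auto intro!: exI[of _ 0] simp: coeffs_in_def)
    next
      case (lin k1 k2)
      then obtain p where p: "coeffs_in E p" "k1 = poly p r" by blast
      have "coeffs_in E (pCons k2 p)" using lin p by (auto simp: coeffs_in_def coeff_pCons split: nat.split)
      moreover have "k1 \<otimes>\<^bsub>R\<^sub>0\<^esub> r \<oplus>\<^bsub>R\<^sub>0\<^esub> k2 = poly (pCons k2 p) r" by (simp add: p)
      ultimately show ?case by blast
    qed
  }
  fix z assume "z \<in> {poly p r | p. coeffs_in E p}"
  then obtain p where p: "coeffs_in E p" "z = poly p r" by blast
  from p(1) have "poly p r \<in> simple_extension E r"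
  proof (induction p)
    case 0
    then show ?case using simple_extension.zero[of E r] by simp
  next
    case (pCons a p)
    have "a \<in> E" "coeffs_in E p"
      using pCons.prems unfolding coeffs_in_def by (metis coeff_pCons_0, metis coeff_pCons_Suc)
    then show ?case using simple_extension.lin[OF pCons.IH, of a] by (simp add: mult.commute add.commute)
  qed
  then show "z \<in> simple_extension E r" using p by simp
qed

text \<open>The value at \<open>poly p r\<close> has to be
  \<open>poly (map_poly \<sigma> p) s\<close>. By \<open>rs\<close> it does not depend on
  \<open>p\<close>, since two polynomials with the same value at \<open>r\<close> differ by one
  vanishing there.\<close>

lemma hom_on_extend:
  fixes E :: "'a::field_char_0 set"
  assumes h: "hom_on E \<sigma>"
    and rs: "\<And>p. coeffs_in E p \<Longrightarrow> poly p r = 0 \<Longrightarrow> poly (map_poly \<sigma> p) s = 0"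
  shows "\<exists>\<tau>. hom_on (ring.simple_extension R\<^sub>0 E r) \<tau> \<and> (\<forall>x\<in>E. \<tau> x = \<sigma> x) \<and> \<tau> r = s"
proof -
  interpret hom_on E \<sigma> by (rule h)
  define F where "F = {poly p r | p. coeffs_in E p}"
  define \<tau> where "\<tau> z = poly (map_poly \<sigma> (SOME p. coeffs_in E p \<and> poly p r = z)) s" for z
  have \<tau>: "\<tau> (poly p r) = poly (map_poly \<sigma> p) s" if p: "coeffs_in E p" for p
  proof -
    define q where "q = (SOME q. coeffs_in E q \<and> poly q r = poly p r)"
    have q: "coeffs_in E q" "poly q r = poly p r"
      using someI[of "\<lambda>q. coeffs_in E q \<and> poly q r = poly p r" p] p by (auto simp: q_def)
    have c: "coeffs_in E (p + - q)" using coeffs_in_add[OF p coeffs_in_minus[OF q(1)]] .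
    have "poly (map_poly \<sigma> (p + - q)) s = 0" by (rule rs[OF c]) (simp add: q)
    then show ?thesis using map_poly_add[OF p coeffs_in_minus[OF q(1)]] map_poly_minus[OF q(1)]
      by (simp add: \<tau>_def q_def)
  qed
  have FI: "poly p r \<in> F" if "coeffs_in E p" for p using that by (auto simp: F_def)
  have const: "coeffs_in E [:a:]" if "a \<in> E" for a
    using coeffs_in_monom[OF that, of 0] by (simp add: monom_0)
  have EF: "a \<in> F" "\<tau> a = \<sigma> a" if "a \<in> E" for a
    using FI[OF const[OF that]] \<tau>[OF const[OF that]] by (simp_all add: map_poly_pCons)
  have "hom_on F \<tau>"
  proof
    show "1 \<in> F" "\<tau> 1 = 1" using EF[OF one] hom_one by auto
    fix x y assume "x \<in> F" "y \<in> F"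
    then obtain p q where p: "coeffs_in E p" "x = poly p r" and q: "coeffs_in E q" "y = poly q r"
      by (auto simp: F_def)
    show "x + y \<in> F" "\<tau> (x + y) = \<tau> x + \<tau> y"
      using FI[OF coeffs_in_add[OF p(1) q(1)]] \<tau>[OF coeffs_in_add[OF p(1) q(1)]] \<tau>[OF p(1)] \<tau>[OF q(1)]
        map_poly_add[OF p(1) q(1)] by (simp_all add: p q)
    show "x * y \<in> F" "\<tau> (x * y) = \<tau> x * \<tau> y"
      using FI[OF coeffs_in_mult[OF p(1) q(1)]] \<tau>[OF coeffs_in_mult[OF p(1) q(1)]] \<tau>[OF p(1)] \<tau>[OF q(1)]
        map_poly_mult[OF p(1) q(1)] by (simp_all add: p q)
    show "- x \<in> F" using FI[OF coeffs_in_minus[OF p(1)]] by (simp add: p)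
  qed
  moreover have "\<tau> r = s"
  proof -
    have "coeffs_in E [:0, 1:]" using const[OF one] zero by (simp add: coeffs_in_pCons)
    from \<tau>[OF this] show ?thesis by (simp add: map_poly_pCons hom_one)
  qed
  ultimately show ?thesis using EF(2) simple_extension_eq_poly[OF zero, of r] by (auto simp: F_def)
qed

text \<open>Take \<open>s\<close> to be a root of the image of a polynomial \<open>m\<close> of
  least degree killing \<open>r\<close>. A polynomial vanishing at \<open>r\<close> is reduced by
  multiples of \<open>m\<close>, by induction on its degree.\<close>

lemma ex_conjugate:
  fixes E :: "'a::field_char_0 set" and \<sigma> :: "'a \<Rightarrow> 'b::alg_closed_field"
  assumes E: "subfield E R\<^sub>0" and h: "hom_on E \<sigma>" and alg: "coeffs_in E f" "f \<noteq> 0" "poly f r = 0"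
  shows "\<exists>s. \<forall>p. coeffs_in E p \<longrightarrow> poly p r = 0 \<longrightarrow> poly (map_poly \<sigma> p) s = 0"
proof -
  interpret hom_on E \<sigma> by (rule h)
  define Q where "Q = (\<lambda>m. coeffs_in E m \<and> m \<noteq> 0 \<and> poly m r = 0)"
  obtain m where m: "Q m" and min: "\<And>p. Q p \<Longrightarrow> Polynomial.degree m \<le> Polynomial.degree p"
    using ex_has_least_nat[of Q f Polynomial.degree] alg by (auto simp: Q_def)
  define l where "l = Polynomial.lead_coeff m"
  have l: "l \<in> E" "l \<noteq> 0" "inverse l \<in> E"
    using m subfield_inverse[OF E, of l] by (auto simp: Q_def l_def coeffs_in_def)
  have degm: "Polynomial.degree m > 0"
  proof (rule ccontr)
    assume "\<not> ?thesis"
    then obtain a where "m = [:a:]" using degree_eq_zeroE[of m] by auto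
    then show False using m by (auto simp: Q_def)
  qed
  \<comment> \<open>The leading coefficient survives \<open>\<sigma>\<close>, so the image of
    \<open>m\<close> is nonconstant and has a root.\<close>
  have "\<sigma> l * \<sigma> (inverse l) = 1" using hom_mult[OF l(1,3)] l(2) hom_one by simp
  then have sl: "\<sigma> l \<noteq> 0" by auto
  then have "Polynomial.degree (map_poly \<sigma> m) \<noteq> 0"
    using degm le_degree[of "map_poly \<sigma> m" "Polynomial.degree m"] by (simp add: coeff_map_poly l_def)
  then obtain s where s: "poly (map_poly \<sigma> m) s = 0"
    using alg_closed_imp_poly_has_root[of "map_poly \<sigma> m"] by auto
  have "poly (map_poly \<sigma> p) s = 0" if "coeffs_in E p" "poly p r = 0" for p
    using that
  proof (induction "Polynomial.degree p" arbitrary: p rule: less_induct)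
    case less
    show ?case
    proof (cases "p = 0")
      case False
      then have deg: "Polynomial.degree m \<le> Polynomial.degree p" using min less.prems by (simp add: Q_def)
      define k where "k = Polynomial.degree p - Polynomial.degree m"
      define a where "a = Polynomial.lead_coeff p * inverse l"
      have a: "a \<in> E" unfolding a_def using less.prems l by (intro mult) (auto simp: coeffs_in_def)
      define t where "t = Polynomial.monom a k * m"
      have mE: "coeffs_in E m" using m by (simp add: Q_def)
      have t: "coeffs_in E t" unfolding t_def by (intro coeffs_in_mult coeffs_in_monom a mE)
      have at: "a \<noteq> 0" using False l by (simp add: a_def)
      have degt: "Polynomial.degree t = Polynomial.degree p"
        unfolding t_def using at m deg by (subst degree_mult_eq) (auto simp: Q_def degree_monom_eq k_def)
      have lt: "Polynomial.coeff t (Polynomial.degree p) = Polynomial.coeff p (Polynomial.degree p)"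
      proof -
        have "Polynomial.lead_coeff t = a * l"
          unfolding t_def lead_coeff_mult l_def using at by (simp add: degree_monom_eq)
        then show ?thesis using degt l by (simp add: a_def)
      qed
      define q where "q = p + - t"
      have q: "coeffs_in E q" unfolding q_def by (intro coeffs_in_add coeffs_in_minus less.prems t)
      have qr: "poly q r = 0" using less.prems m by (simp add: q_def t_def Q_def)
      \<comment> \<open>The leading terms cancel. The drop is strict because the degree of
        \<open>p\<close> is at least that of \<open>m\<close>, hence positive.\<close>
      have "Polynomial.degree q < Polynomial.degree p"
      proof -
        have "Polynomial.degree q \<le> Polynomial.degree p"
          unfolding q_def using degt by (intro degree_add_le) auto
        moreover have "Polynomial.coeff q (Polynomial.degree p) = 0" using lt by (simp add: q_def)
        ultimately show ?thesis using deg degm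
          by (metis coeff_0_degree_minus_1 leading_coeff_0_iff le_neq_implies_less degree_0 order.strict_trans2)
      qed
      then have "poly (map_poly \<sigma> q) s = 0" using less.hyps q qr by blast
      moreover have "poly (map_poly \<sigma> t) s = 0"
        using map_poly_mult[OF coeffs_in_monom[OF a] mE] s by (simp add: t_def)
      ultimately show ?thesis
        using map_poly_add[OF less.prems(1) coeffs_in_minus[OF t]] map_poly_minus[OF t] by (simp add: q_def)
    qed simp
  qed
  then show ?thesis by blast
qed

section \<open>Rational polynomials and their roots\<close>

interpretation of_rat_hom: hom_on "UNIV :: rat set" "of_rat :: rat \<Rightarrow> 'a::field_char_0"
  by unfold_locales (auto simp: of_rat_add of_rat_mult)

lemma coeffs_in_UNIV [simp]: "coeffs_in UNIV p"
  by (simp add: coeffs_in_def)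

lemma coeffs_in_Rats: "coeffs_in \<rat> p \<longleftrightarrow> (\<exists>f. p = map_poly of_rat f)"
proof
  assume p: "coeffs_in \<rat> p"
  define g where "g x = (SOME q. of_rat q = x)" for x :: 'a
  have g: "of_rat (g x) = x" if "x \<in> \<rat>" for x
    unfolding g_def by (rule someI_ex) (use that in \<open>auto elim: Rats_cases\<close>)
  have g0: "g 0 = 0" using g[of 0] by simp
  have "p = map_poly of_rat (map_poly g p)"
    by (intro poly_eqI) (use p in \<open>simp add: coeff_map_poly g0 g coeffs_in_def\<close>)
  then show "\<exists>f. p = map_poly of_rat f" by blast
qed (auto simp: coeffs_in_def coeff_map_poly)

text \<open>Here two encodings of polynomials meet: \<open>univ_poly\<close> uses coefficient lists
  with the leading coefficient first, hence \<open>rev (coeffs g)\<close>.\<close>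

lemma algebraic_over_RatsI:
  assumes f: "f \<noteq> 0" "poly (map_poly of_rat f) r = 0"
  shows "ring.algebraic R\<^sub>0 \<rat> r"
proof -
  interpret field R\<^sub>0 by (rule type_ring_field)
  have ev: "eval (rev (coeffs g)) x = poly g x" for g x
  proof (induction g)
    case (pCons a g)
    then show ?case by (auto simp: cCons_def eval_append_aux add.commute mult.commute)
  qed simp
  define g where "g = (map_poly of_rat f :: 'a poly)"
  have g: "g \<noteq> 0" "poly g r = 0" using f by (auto simp: g_def map_poly_eq_0_iff)
  have "coeffs_in \<rat> g" unfolding coeffs_in_Rats g_def by blast
  then have "set (coeffs g) \<subseteq> \<rat>" by (auto simp: coeffs_in_def coeffs_def)
  moreover have "rev (coeffs g) \<noteq> []" "hd (rev (coeffs g)) \<noteq> 0"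
    using g by (simp_all add: hd_rev last_coeffs_eq_coeff_degree)
  ultimately have "rev (coeffs g) \<in> carrier (univ_poly R\<^sub>0 \<rat>)"
    by (auto simp: univ_poly_def polynomial_def)
  then show ?thesis using algebraicI[of "rev (coeffs g)" \<rat> r] g ev[of g r] by (simp add: over_def)
qed

lemma rat_poly_bezout:
  fixes f g :: "rat poly"
  assumes "Factorial_Ring.irreducible f" "\<not> f dvd g"
  obtains a b where "a * f + b * g = 1"
proof -
  have "Rings.coprime f g" using prime_elem_imp_coprime[OF irreducible_imp_prime_elem] assms by blast
  then have "gcd f g = 1" by simp
  then show ?thesis using that bezout_coefficients_fst_snd[of f g] by metis
qed

lemma of_rat_poly_mult: "map_poly of_rat (p * q) = map_poly of_rat p * (map_poly of_rat q :: 'a::field_char_0 poly)"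
  by (rule of_rat_hom.map_poly_mult) auto

lemma of_rat_poly_add: "map_poly of_rat (p + q) = map_poly of_rat p + (map_poly of_rat q :: 'a::field_char_0 poly)"
  by (rule of_rat_hom.map_poly_add) auto

text \<open>Otherwise a Bezout identity for \<open>f\<close> and \<open>g\<close>, evaluated at
  \<open>x\<close>, would read \<open>0 = 1\<close>.\<close>

lemma irreducible_dvd_if_common_root:
  assumes f: "Factorial_Ring.irreducible f" "poly (map_poly of_rat f) x = (0 :: 'a::field_char_0)"
    and g: "poly (map_poly of_rat g) x = 0"
  shows "f dvd g"
proof (rule ccontr)
  assume "\<not> f dvd g"
  then obtain a b where ab: "a * f + b * g = 1" using rat_poly_bezout f(1) by blast
  have "map_poly of_rat (a * f + b * g) = (1 :: 'a poly)" unfolding ab by simp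
  then have "map_poly of_rat a * map_poly of_rat f + map_poly of_rat b * map_poly of_rat g = (1 :: 'a poly)"
    by (simp add: of_rat_poly_add of_rat_poly_mult)
  from arg_cong[OF this, of "\<lambda>p. poly p x"] show False using f g by simp
qed

text \<open>A multiple root is shared with the derivative, so \<open>f\<close> would divide
  \<open>pderiv f\<close>, which is nonzero in characteristic 0 and of smaller degree.\<close>

lemma irreducible_simple_roots:
  assumes f: "Factorial_Ring.irreducible f" and A: "map_poly of_rat f = Polynomial.smult c (\<Prod>x\<in>#A. [:- x, 1:])"
  shows "count A (z :: 'a::field_char_0) \<le> 1"
proof (rule ccontr)
  assume "\<not> ?thesis"
  then have "count A z \<ge> 2" by simp
  then have "{#z, z#} \<subseteq># A" by (simp add: subseteq_mset_def)
  then obtain B where B: "A = {#z, z#} + B" using subset_mset.le_iff_add by blast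
  define h where "h = Polynomial.smult c (\<Prod>x\<in>#B. [:- x, 1:])"
  have fh: "map_poly of_rat f = [:-z, 1:] * ([:-z, 1:] * h)" by (simp add: A B h_def)
  have "map_poly of_rat (pderiv f) = pderiv (map_poly of_rat f :: 'a poly)"
    by (intro poly_eqI) (simp add: coeff_map_poly coeff_pderiv of_rat_mult of_rat_add)
  then have "poly (map_poly of_rat (pderiv f)) z = 0"
    unfolding fh by (simp add: pderiv_mult del: mult_pCons_left)
  moreover have "poly (map_poly of_rat f) z = 0" unfolding fh by simp
  ultimately have dvd: "f dvd pderiv f" using irreducible_dvd_if_common_root[OF f] by blast
  have "Polynomial.degree f \<noteq> 0"
  proof
    assume "Polynomial.degree f = 0"
    then obtain a where "f = [:a:]" by (rule degree_eq_zeroE)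
    then show False using f by (cases "a = 0") (auto simp: Factorial_Ring.irreducible_def is_unit_const_poly_iff dvd_field_iff)
  qed
  then have "pderiv f \<noteq> 0" by (simp add: pderiv_eq_0_iff)
  then have "Polynomial.degree f \<le> Polynomial.degree (pderiv f)" using dvd by (rule dvd_imp_degree_le[rotated])
  then show False using \<open>Polynomial.degree f \<noteq> 0\<close> by (simp add: degree_pderiv)
qed

section \<open>Splitting fields, normality and the Galois closure\<close>

lemma number_field_rat_poly:
  assumes K: "number_field K" and x: "x \<in> K"
  shows "\<exists>f. f \<noteq> 0 \<and> poly (map_poly of_rat f) x = 0"
proof -
  obtain d where d: "\<exists>i<Suc (nf_degree K). d i \<noteq> 0" "(\<Sum>i<Suc (nf_degree K). of_int (d i) * x ^ i) = 0"
    using number_field_int_dependent[OF K, of "Suc (nf_degree K)" "\<lambda>i. x ^ i"]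
      subfield_power[OF number_field_subfield[OF K] x] by blast
  define f :: "rat poly" where "f = (\<Sum>i<Suc (nf_degree K). Polynomial.monom (of_int (d i)) i)"
  have c: "Polynomial.coeff f i = (if i < Suc (nf_degree K) then of_int (d i) else 0)" for i
    by (simp add: f_def coeff_sum coeff_monom del: sum.lessThan_Suc)
  have "f \<noteq> 0" using d(1) c by (metis coeff_0 of_int_eq_0_iff)
  moreover have "map_poly of_rat f = (\<Sum>i<Suc (nf_degree K). Polynomial.monom (of_int (d i) :: 'a) i)"
    by (intro poly_eqI) (simp add: coeff_map_poly c coeff_sum coeff_monom del: sum.lessThan_Suc)
  then have "poly (map_poly of_rat f) x = (\<Sum>i<Suc (nf_degree K). of_int (d i) * x ^ i)"
    by (simp add: poly_sum poly_monom del: sum.lessThan_Suc)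
  ultimately show ?thesis using d(2) by auto
qed


text \<open>Generators are adjoined one at a time; each intermediate ring is a field because the
  generators are algebraic, so a conjugate for the next one exists.\<close>

lemma hom_on_extend_list:
  fixes E :: "'a::field_char_0 set" and \<sigma> :: "'a \<Rightarrow> 'b::alg_closed_field"
  assumes E: "subfield E R\<^sub>0" and h: "hom_on E \<sigma>"
    and ys: "\<And>y. y \<in> set ys \<Longrightarrow> \<exists>f. f \<noteq> 0 \<and> poly (map_poly of_rat f) y = 0"
  shows "\<exists>\<tau>. hom_on (ring.finite_extension R\<^sub>0 E ys) \<tau> \<and> (\<forall>x\<in>E. \<tau> x = \<sigma> x)"
proof -
  interpret field R\<^sub>0 by (rule type_ring_field)
  have QE: "\<rat> \<subseteq> E" using subfield_of_rat[OF E] by (auto elim: Rats_cases)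
  show ?thesis using ys
  proof (induction ys)
    case Nil
    then show ?case using h by auto
  next
    case (Cons y ys)
    define F where "F = finite_extension E ys"
    obtain \<tau> where \<tau>: "hom_on F \<tau>" "\<forall>x\<in>E. \<tau> x = \<sigma> x" using Cons by (auto simp: F_def)
    have "(algebraic over E) z" if "z \<in> set ys" for z
      using algebraic_mono[OF QE] algebraic_over_RatsI Cons.prems[of z] that by (auto simp: over_def)
    then have F: "subfield F R\<^sub>0" unfolding F_def by (intro finite_extension_is_subfield[OF E]) auto
    have EF: "E \<subseteq> F" unfolding F_def by (rule finite_extension_incl) auto
    obtain f where f: "f \<noteq> 0" "poly (map_poly of_rat f) y = 0" using Cons.prems[of y] by auto
    have fF: "coeffs_in F (map_poly of_rat f)" "map_poly of_rat f \<noteq> (0 :: 'a poly)"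
      using f subfield_of_rat[OF F] by (auto simp: coeffs_in_def coeff_map_poly map_poly_eq_0_iff)
    obtain s where s: "\<forall>p. coeffs_in F p \<longrightarrow> poly p y = 0 \<longrightarrow> poly (map_poly \<tau> p) s = 0"
      using ex_conjugate[OF F \<tau>(1) fF f(2)] by blast
    obtain \<upsilon> where "hom_on (simple_extension F y) \<upsilon>" "\<forall>x\<in>F. \<upsilon> x = \<tau> x"
      using hom_on_extend[OF \<tau>(1), of y s] s by blast
    then show ?case using \<tau>(2) EF by (intro exI[of _ \<upsilon>]) (auto simp: F_def)
  qed
qed

text \<open>
  An embedding sending \<open>x\<close> to its conjugate \<open>y\<close> permutes the roots of \<open>F\<close>, hence maps \<open>L\<close> to itself.
\<close>

lemma splitting_field_normal:
  fixes F :: "rat poly"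
  defines "Z \<equiv> {z :: 'a::{alg_closed_field, field_char_0}. poly (map_poly of_rat F) z = 0}"
  assumes F: "F \<noteq> 0" and xs: "set xs = Z" and L: "L = ring.finite_extension R\<^sub>0 \<rat> xs"
    and f: "Factorial_Ring.irreducible f" and x: "x \<in> L" "poly (map_poly of_rat f) x = 0"
    and y: "poly (map_poly of_rat f) y = 0"
  shows "y \<in> L"
proof -
  interpret field R\<^sub>0 by (rule type_ring_field)
  have QL: "\<rat> \<subseteq> L" unfolding L by (rule finite_extension_incl) auto
  have subr: "subring L R\<^sub>0" unfolding L by (intro finite_extension_is_subring subfieldE(1)[OF Rats_subfield]) auto
  have ZL: "Z \<subseteq> L" unfolding L xs[symmetric] by (intro finite_extension_mem subfieldE(1)[OF Rats_subfield]) auto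
  have id: "hom_on \<rat> (\<lambda>x::'a. x)" by unfold_locales auto
  \<comment> \<open>Every rational relation of \<open>x\<close> is a multiple of \<open>f\<close>,
    so sending \<open>x\<close> to \<open>y\<close> is well defined.\<close>
  have "poly (map_poly (\<lambda>x. x) p) y = 0" if p: "coeffs_in \<rat> p" "poly p x = 0" for p
  proof -
    obtain g where g: "p = map_poly of_rat g" using p coeffs_in_Rats by blast
    then have "f dvd g" using irreducible_dvd_if_common_root[OF f x(2)] p by blast
    then obtain k where "g = f * k" by (elim dvdE)
    then show ?thesis using y by (simp add: g of_rat_poly_mult)
  qed
  from hom_on_extend[OF id, of x y] this
  obtain \<sigma> where \<sigma>: "hom_on (simple_extension \<rat> x) \<sigma>" "\<forall>z\<in>\<rat>. \<sigma> z = z" "\<sigma> x = y" by auto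
  have algx: "(algebraic over \<rat>) x"
    using algebraic_over_RatsI[of f x] f x(2) by (auto simp: over_def Factorial_Ring.irreducible_def)
  define E where "E = simple_extension \<rat> x"
  have E: "subfield E R\<^sub>0" unfolding E_def using finite_extension_is_subfield[OF Rats_subfield, of "[x]"] algx by simp
  have "\<exists>g. g \<noteq> 0 \<and> poly (map_poly of_rat g) z = 0" if "z \<in> set xs" for z
    using that F xs by (auto simp: Z_def)
  then obtain \<tau> where \<tau>: "hom_on (finite_extension E xs) \<tau>" "\<forall>z\<in>E. \<tau> z = \<sigma> z"
    using hom_on_extend_list[OF E, of \<sigma> xs] \<sigma>(1) by (auto simp: E_def)
  interpret \<tau>: hom_on "finite_extension E xs" \<tau> by (rule \<tau>(1))
  have QE: "\<rat> \<subseteq> E" unfolding E_def by (rule simple_extension_incl) auto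
  have xE: "x \<in> E" unfolding E_def by (intro simple_extension_mem subfieldE(1)[OF Rats_subfield]) auto
  have LM: "L \<subseteq> finite_extension E xs" unfolding L by (rule mono_finite_extension[OF QE])
  have \<tau>Q: "\<tau> z = z" if "z \<in> \<rat>" for z using that \<tau>(2) \<sigma>(2) QE by auto
  have \<tau>Z: "\<tau> z \<in> Z" if z: "z \<in> Z" for z
  proof -
    have "coeffs_in (finite_extension E xs) (map_poly of_rat F)"
      using subsetD[OF LM subsetD[OF QL Rats_of_rat]] by (simp add: coeffs_in_def coeff_map_poly)
    from \<tau>.hom_poly[OF this, of z] have "\<tau> (poly (map_poly of_rat F) z) = poly (map_poly \<tau> (map_poly of_rat F)) (\<tau> z)"
      using z ZL LM by blast
    moreover have "map_poly \<tau> (map_poly of_rat F) = map_poly of_rat F"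
      by (intro poly_eqI) (simp add: coeff_map_poly \<tau>Q)
    ultimately show ?thesis using z by (simp add: Z_def)
  qed
  \<comment> \<open>The elements of \<open>L\<close> that \<open>\<tau>\<close> keeps in
    \<open>L\<close> form a subring containing the rationals and the roots of \<open>F\<close>,
    hence all of \<open>L\<close>.\<close>
  define L' where "L' = {z \<in> L. \<tau> z \<in> L}"
  note sr = subringE[OF subr]
  have "subring L' R\<^sub>0"
  proof (rule subringI)
    show "\<one>\<^bsub>R\<^sub>0\<^esub> \<in> L'" using sr(3) \<tau>.hom_one by (simp add: L'_def)
  next
    fix h assume h: "h \<in> L'"
    then show "\<ominus>\<^bsub>R\<^sub>0\<^esub> h \<in> L'" using sr(5)[of h] sr(5)[of "\<tau> h"] \<tau>.hom_minus[of h] LM by (auto simp: L'_def)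
  next
    fix a b assume "a \<in> L'" "b \<in> L'"
    then have ab: "a \<in> L" "b \<in> L" "\<tau> a \<in> L" "\<tau> b \<in> L" by (auto simp: L'_def)
    moreover have "\<tau> (a + b) = \<tau> a + \<tau> b" "\<tau> (a * b) = \<tau> a * \<tau> b"
      using \<tau>.hom_add \<tau>.hom_mult ab LM by blast+
    ultimately show "a \<otimes>\<^bsub>R\<^sub>0\<^esub> b \<in> L'" "a \<oplus>\<^bsub>R\<^sub>0\<^esub> b \<in> L'"
      using sr(6)[of a b] sr(6)[of "\<tau> a" "\<tau> b"] sr(7)[of a b] sr(7)[of "\<tau> a" "\<tau> b"] by (auto simp: L'_def)
  qed auto
  then have "L \<subseteq> L'" unfolding L
    by (rule finite_extension_subring_incl) (use QL \<tau>Q \<tau>Z ZL xs in \<open>auto simp: L'_def\<close>)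
  then have "\<tau> x \<in> L" using x(1) by (auto simp: L'_def)
  then show ?thesis using \<tau>(2) xE \<sigma>(3) by simp
qed

text \<open>The extension \<open>L\<close> is generated by the roots of a product of rational
  polynomials, one killing each member of a basis of \<open>K\<close>.\<close>

theorem ex_galois_extension:
  fixes K :: "'a::{alg_closed_field, field_char_0} set"
  assumes K: "number_field K"
  shows "\<exists>L. K \<subseteq> L \<and> galois_number_field L"
proof -
  interpret field R\<^sub>0 by (rule type_ring_field)
  obtain n where "dimension n \<rat> K" using K by (auto simp: number_field_def finite_dimension_def over_def)
  then obtain Vs where Vs: "Span \<rat> Vs = K" using exists_base[OF Rats_subfield] by blast
  have VK: "set Vs \<subseteq> K" using Span_base_incl[OF Rats_subfield, of Vs] Vs by auto
  obtain \<phi> where \<phi>: "\<And>x. x \<in> K \<Longrightarrow> \<phi> x \<noteq> 0" "\<And>x. x \<in> K \<Longrightarrow> poly (map_poly of_rat (\<phi> x)) x = 0"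
    using number_field_rat_poly[OF K] by metis
  define F where "F = (\<Prod>x\<in>set Vs. \<phi> x)"
  have F0: "F \<noteq> 0" using \<phi>(1) VK by (auto simp: F_def)
  define Z where "Z = {z :: 'a. poly (map_poly of_rat F) z = 0}"
  have mF0: "map_poly of_rat F \<noteq> (0 :: 'a poly)" using F0 by (simp add: map_poly_eq_0_iff)
  have "finite Z" unfolding Z_def by (rule poly_roots_finite[OF mF0])
  then obtain xs where xs: "set xs = Z" using finite_list by blast
  have VZ: "set Vs \<subseteq> Z"
  proof
    fix x assume x: "x \<in> set Vs"
    then have "F = \<phi> x * (\<Prod>x\<in>set Vs - {x}. \<phi> x)" by (simp add: F_def prod.remove)
    then show "x \<in> Z" using \<phi>(2)[of x] VK x by (auto simp: Z_def of_rat_poly_mult)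
  qed
  define L where "L = finite_extension \<rat> xs"
  have alg: "(algebraic over \<rat>) z" if "z \<in> set xs" for z
    using that xs algebraic_over_RatsI[OF F0, of z] by (simp add: Z_def over_def)
  have L: "subfield L R\<^sub>0" unfolding L_def by (rule finite_extension_is_subfield[OF Rats_subfield]) (use alg in auto)
  have Lfin: "finite_dimension \<rat> L"
    unfolding L_def by (rule finite_extension_finite_dimension(1)[OF Rats_subfield]) (use alg in auto)
  have ZL: "Z \<subseteq> L" unfolding L_def xs[symmetric] by (intro finite_extension_mem subfieldE(1)[OF Rats_subfield]) auto
  have "Span \<rat> Vs \<subseteq> L"
  proof (rule Span_min[OF Rats_subfield])
    show "subgroup L (add_monoid R\<^sub>0)" using subring.axioms(1)[OF subfieldE(1)[OF L]] .
    show "\<rat> <#>\<^bsub>R\<^sub>0\<^esub> set Vs \<subseteq> L"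
      using subfield_of_rat[OF L] subfield_mult[OF L] VZ ZL by (auto simp: set_mult_def elim!: Rats_cases)
  qed auto
  then have KL: "K \<subseteq> L" using Vs by simp
  have "galois_number_field L" unfolding galois_number_field_def
  proof (intro conjI allI impI)
    show "number_field L" using L Lfin by (simp add: number_field_def)
    fix f :: "rat poly" assume f: "Factorial_Ring.irreducible f" "\<exists>x\<in>L. poly (map_poly of_rat f) x = 0"
    then obtain x where x: "x \<in> L" "poly (map_poly of_rat f) x = 0" by blast
    have f0: "map_poly of_rat f \<noteq> (0 :: 'a poly)" using f(1) by (auto simp: map_poly_eq_0_iff Factorial_Ring.irreducible_def)
    have lc: "Polynomial.lead_coeff (map_poly of_rat f :: 'a poly) = of_rat (Polynomial.lead_coeff f)"
      by (simp add: coeff_map_poly degree_map_poly)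
    obtain A where A: "map_poly of_rat f = Polynomial.smult (of_rat (Polynomial.lead_coeff f)) (\<Prod>x\<in>#A. [:- x, 1 :: 'a:])"
      using alg_closed_imp_factorization[OF f0] unfolding lc by blast
    obtain rs where rs: "mset rs = A" using ex_mset by blast
    have "\<forall>z. count (mset rs) z \<le> 1" using irreducible_simple_roots[OF f(1) A] rs by simp
    then have "distinct rs" by (metis distinct_count_atmost_1 count_mset le_neq_implies_less count_greater_zero_iff less_one in_multiset_in_set not_gr_zero)
    moreover have eq: "map_poly of_rat f = Polynomial.smult (of_rat (Polynomial.lead_coeff f)) (\<Prod>r\<leftarrow>rs. [:- r, 1 :: 'a:])"
      using A by (simp add: rs[symmetric] prod_mset_prod_list[symmetric])
    moreover have "set rs \<subseteq> L"
    proof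
      fix y assume "y \<in> set rs"
      then have "y \<in># A" using rs by auto
      then have "poly (map_poly of_rat f) y = 0" unfolding A by (auto simp: poly_prod_mset)
      then show "y \<in> L"
        using splitting_field_normal[OF F0, of xs L f x y] xs f(1) x by (simp add: Z_def L_def)
    qed
    ultimately show "\<exists>rs. set rs \<subseteq> L \<and> distinct rs \<and> map_poly of_rat f =
        Polynomial.smult (of_rat (Polynomial.lead_coeff f)) (\<Prod>r\<leftarrow>rs. [:- r, 1:])" by blast
  qed
  then show ?thesis using KL by blast
qed

section \<open>Continuity at zero\<close>

text \<open>Fractions with denominator prime to \<open>p\<close> form a ring. An infinite
  \<open>A\<close> is covered as well, its sum being 0 by convention.\<close>

lemma sum_p_integral:
  fixes t :: "'b \<Rightarrow> rat" and p :: int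
  assumes p: "Factorial_Ring.prime p"
    and t: "\<And>a. a \<in> A \<Longrightarrow> \<exists>u w::int. \<not> p dvd w \<and> t a = of_int u / of_int w"
  shows "\<exists>u w::int. \<not> p dvd w \<and> sum t A = of_int u / of_int w"
proof -
  have zero: "\<exists>u w::int. \<not> p dvd w \<and> (0::rat) = of_int u / of_int w"
    using p by (intro exI[of _ 0] exI[of _ 1]) (auto simp: not_prime_unit)
  show ?thesis using t
  proof (induction A rule: infinite_finite_induct)
    case (insert a A)
    obtain u w where 1: "\<not> p dvd w" "t a = of_int u / of_int w" using insert.prems[of a] by auto
    obtain u' w' where 2: "\<not> p dvd w'" "sum t A = of_int u' / of_int w'" using insert by auto
    have "w \<noteq> 0" "w' \<noteq> 0" using 1 2 by auto
    then have "sum t (insert a A) = of_int (u * w' + u' * w) / of_int (w * w')"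
      using insert.hyps 1 2 by (simp add: add_frac_eq)
    moreover have "\<not> p dvd w * w'" using 1 2 p by (simp add: prime_dvd_mult_iff)
    ultimately show ?case by blast
  qed (use zero in auto)
qed

text \<open>The valuation is an integer over the ramification index \<open>e\<close>. Both
  \<open>e\<close> and \<open>g\<close> divide \<open>fact n\<close>, so the square of the factorial
  clears them. The remaining denominator \<open>q\<close> is cancelled by \<open>p\<close> if
  \<open>q = p\<close> and is prime to \<open>p\<close> otherwise.\<close>

lemma subderiv_term_p_integral:
  fixes p :: nat
  assumes L: "number_field L" and Q: "Q \<in> nonzero_primes L" and p: "Factorial_Ring.prime p"
  shows "\<exists>u w::int. \<not> int p dvd w \<and>
    of_nat (p * (fact (nf_degree L))\<^sup>2) *
      (val L Q x / (of_nat (prime_below Q) * of_nat (num_primes_over (prime_below Q) L))) = of_int u / of_int w"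
proof -
  interpret nf_prime L Q by unfold_locales (use L Q in auto)
  define n where "n = nf_degree L"
  define q where "q = prime_below Q"
  define g where "g = num_primes_over q L"
  define e where "e = nat (ord_frac L Q (of_nat q))"
  define k where "k = ord_frac L Q x"
  have pq: "nf_prime.p Q = q" unfolding q_def by (rule p_def)
  have e: "1 \<le> e" "e \<le> n" "ord_frac L Q (of_nat q) = int e"
    using ord_frac_p unfolding pq by (auto simp: e_def n_def)
  have v: "val L Q x = of_int k / of_nat e" using val_eq[of x] e by (simp add: pq k_def)
  have gn: "g \<le> n" unfolding g_def n_def by (rule num_primes_over_le_degree[OF L])
  have prq: "Factorial_Ring.prime q" using prime_p pq by simp
  have nu: "\<not> int p dvd 1" using p by (metis not_prime_unit prime_nat_int_transfer)
  have "\<exists>u w::int. \<not> int p dvd w \<and>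
    of_nat (p * (fact n)\<^sup>2) * (val L Q x / (of_nat q * of_nat g)) = of_int u / of_int w"
  proof (cases "g = 0")
    \<comment> \<open>For \<open>g = 0\<close> the term is 0, because division by 0 gives 0.\<close>
    case True
    then show ?thesis using nu by (intro exI[of _ 0] exI[of _ 1]) auto
  next
    case False
    have "e dvd fact n" "g dvd fact n" using e gn False by (auto intro: dvd_fact)
    then obtain a b where ab: "fact n = e * a" "fact n = g * b" by (elim dvdE)
    have "of_nat (p * (fact n)\<^sup>2) = (of_nat p * of_nat (e * a) * of_nat (g * b) :: rat)"
      by (metis ab mult.assoc of_nat_mult power2_eq_square)
    note N = this
    have eq: "of_nat (p * (fact n)\<^sup>2) * (val L Q x / (of_nat q * of_nat g))
        = of_int (int p * k * int a * int b) / of_int (int q)"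
      unfolding N v using False e(1) by (simp add: field_simps)
    show ?thesis
    proof (cases "p = q")
      case True
      then have "of_nat (p * (fact n)\<^sup>2) * (val L Q x / (of_nat q * of_nat g)) = of_int (k * int a * int b) / of_int 1"
        unfolding eq using prq by simp
      then show ?thesis using nu by blast
    next
      case False
      then have "\<not> int p dvd int q" using p prq primes_dvd_imp_eq[of p q] by auto
      then show ?thesis using eq by blast
    qed
  qed
  then show ?thesis unfolding n_def q_def g_def .
qed

theorem theorem5p6:
  fixes K :: "'a::{alg_closed_field, field_char_0} set"
    and \<pp> :: "'a set" and T :: "'a set set" and c :: real
  assumes "number_field K"
    and "\<pp> \<in> nonzero_primes K"
    and "T \<noteq> {}" and "T \<subseteq> nonzero_primes K"
    and "0 < c" and "c < 1"
  shows "padic_continuous_at c K \<pp> (arith_subderiv K T) 0"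
proof -
  interpret nf_prime K \<pp> by unfold_locales (use assms in auto)
  define L where "L = galois_extension_of K"
  have "K \<subseteq> L \<and> galois_number_field L"
    unfolding L_def galois_extension_of_def by (rule someI_ex[OF ex_galois_extension[OF assms(1)]])
  then have L: "number_field L" by (simp add: galois_number_field_def)
  define T' where "T' = primes_above L K T"
  have T': "T' \<subseteq> nonzero_primes L" by (auto simp: T'_def primes_above_def)
  define t where "t x Q = val L Q x / (of_nat (prime_below Q) * of_nat (num_primes_over (prime_below Q) L))" for x Q
  define S where "S x = (\<Sum>Q \<in> {Q \<in> T'. val L Q x \<noteq> 0}. t x Q)" for x
  define N where "N = p * (fact (nf_degree L))\<^sup>2"
  define D where "D = arith_subderiv K T"
  \<comment> \<open>Both sides vanish at \<open>x = 0\<close>, so the formula needs no case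
    distinction.\<close>
  have D: "D x = x * of_rat (S x)" for x
    by (simp add: D_def arith_subderiv_def subderiv_galois_def S_def t_def T'_def L_def)
  have N0: "N \<noteq> 0" using prime_p by (auto simp: N_def)
  \<comment> \<open>Integrality at \<open>p\<close> is checked term by term;
    \<open>sum_p_integral\<close> allows any index set.\<close>
  have S: "\<exists>u w::int. \<not> int p dvd w \<and> of_nat N * S x = of_int u / of_int w" for x
    unfolding S_def sum_distrib_left
    by (rule sum_p_integral[OF prime_int_p])
      (use subderiv_term_p_integral[OF L _ prime_p] T' in \<open>auto simp: N_def t_def\<close>)
  have key: "val K \<pp> (D x) \<ge> val K \<pp> x - val K \<pp> (of_nat N)" if x: "x \<in> K" "x \<noteq> 0" and s: "S x \<noteq> 0" for x
  proof -
    obtain u w :: int where uw: "\<not> int p dvd w" "of_nat N * S x = of_int u / of_int w" using S by blast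
    have w0: "w \<noteq> 0" using uw(1) by auto
    have u0: "u \<noteq> 0" using uw(2) s N0 w0 by auto
    have "of_nat N * S x * of_int w = of_int u" using uw(2) w0 by simp
    then have "of_rat (of_nat N * S x * of_int w) = (of_int u :: 'a)" by simp
    \<comment> \<open>Taking valuations gives the bound: \<open>w\<close> has valuation 0 and that
      of the integer \<open>u\<close> is nonnegative.\<close>
    then have "D x * of_nat N * of_int w = x * of_int u" by (simp add: D of_rat_mult mult_ac)
    moreover have DK: "D x \<in> K" "D x \<noteq> 0"
      using x s subfield_mult[OF K_sub x(1) subfield_of_rat[OF K_sub]] by (auto simp: D)
    moreover have NK: "of_nat N \<in> K" "of_nat N \<noteq> (0::'a)" using N0 subfield_of_nat[OF K_sub] by auto
    moreover have wK: "of_int w \<in> K" "of_int w \<noteq> (0::'a)" "of_int u \<in> K" "of_int u \<noteq> (0::'a)"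
      using w0 u0 subfield_of_int[OF K_sub] by auto
    moreover have "D x * of_nat N \<in> K" "D x * of_nat N \<noteq> 0"
      using subfield_mult[OF K_sub DK(1) NK(1)] DK NK by auto
    ultimately have "val K \<pp> (D x) + val K \<pp> (of_nat N) + val K \<pp> (of_int w) = val K \<pp> x + val K \<pp> (of_int u)"
      using val_mult[of "D x * of_nat N" "of_int w"] val_mult[of "D x" "of_nat N"] val_mult[of x "of_int u"] x
      by simp
    then show ?thesis using val_of_int_coprime[OF uw(1)] val_integral_nonneg[OF O_of_int wK(4)] by simp
  qed
  show ?thesis
    unfolding padic_continuous_at_def D_def[symmetric]
  proof (intro conjI allI impI)
    show "0 \<in> K" by (rule subfield_0[OF K_sub])
    show "D \<in> K \<rightarrow> K" using subfield_mult[OF K_sub _ subfield_of_rat[OF K_sub]] by (auto simp: D)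
    fix \<epsilon> :: real assume \<epsilon>: "\<epsilon> > 0"
    define C where "C = real_of_rat (val K \<pp> (of_nat N))"
    show "\<exists>\<delta>>0. \<forall>x\<in>K. padic_abs c K \<pp> (x - 0) < \<delta> \<longrightarrow> padic_abs c K \<pp> (D x - D 0) < \<epsilon>"
    \<comment> \<open>By \<open>key\<close>, the subderivative enlarges the absolute value by at
      most the factor \<open>1 / c powr C\<close>, as \<open>c < 1\<close>.\<close>
    proof (intro exI[of _ "\<epsilon> * c powr C"] conjI ballI impI)
      show "\<epsilon> * c powr C > 0" using \<epsilon> assms by simp
      fix x assume x: "x \<in> K" and small: "padic_abs c K \<pp> (x - 0) < \<epsilon> * c powr C"
      show "padic_abs c K \<pp> (D x - D 0) < \<epsilon>"
      proof (cases "x = 0 \<or> S x = 0")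
        case True
        then show ?thesis using \<epsilon> by (auto simp: D padic_abs_def)
      next
        case False
        then have "real_of_rat (val K \<pp> x) - C \<le> real_of_rat (val K \<pp> (D x))"
          using key[OF x] by (simp add: C_def of_rat_less_eq flip: of_rat_diff)
        then have "c powr real_of_rat (val K \<pp> (D x)) \<le> c powr (real_of_rat (val K \<pp> x) - C)"
          using assms by (intro powr_mono') auto
        also have "\<dots> = c powr real_of_rat (val K \<pp> x) / c powr C" using assms by (simp add: powr_diff)
        also have "\<dots> < \<epsilon>" using small False assms by (simp add: padic_abs_def field_simps)
        finally show ?thesis using False by (simp add: padic_abs_def D)
      qed
    qed
  qed
qed

end
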